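(* Let $I\subset R$ be a bihomogeneous ideal, let $(a,b)$ be an admissible bidegree for $I$, and let $h$ be an admissible linear form for $(a,b)$. Then the kernel of the ring homomorphism $$(R_{X,h})_0\longrightarrow k[\,m_{g'} : g'\in (R_{X,h})_0\,],\qquad g'\mapsto m_{g'},$$ is the zero-degree part of the localization of $J_b$ at $h$, i.e. the ideal $(J_b\otimes_{R_X}R_{X,h})_0\subseteq (R_{X,h})_0$.
   Context: Let $k$ be a field and $R=k[x_0,\dots,x_n,y_0,\dots,y_m]$ with the $\mathbb{Z}^2$-grading $\deg(x_i)=(1,0)$, $\deg(y_j)=(0,1)$; put $R_X=k[x_0,\dots,x_n]$ and $\mathfrak m_y=\langle y_0,\dots,y_m\rangle$. An ideal is bihomogeneous if it is generated by bihomogeneous elements. The subscript $a,b$ (or $(a,b)$) denotes the bidegree-$(a,b)$ component, and $\mathrm{HF}_{R/I}(a,b)=\dim_k(R/I)_{a,b}$. Admissible: a bidegree $(a,b)\in\mathbb{Z}_{\ge0}^2$ is admissible for $I$ if $I$ is generated in bidegrees componentwise $\le(a,b)$ and there is a polynomial $h$ of bidegree $(1,0)$ with $\mathrm{HF}_{R/I}(a,b)=\mathrm{HF}_{R/I}(a+1,b)$ and $\mathrm{HF}_{R/(I,h)}(a,b)=0$; such an $h$ is called an admissible linear form for $(a,b)$. $J_b:=(I:\mathfrak m_y^b)\cap R_X=\mathrm{Ann}_{R_X}\big(\bigoplus_{a'}(R/I)_{a',b}\big)$. $R_{X,h}$ is the localization of $R_X$ at the multiplicative set generated by $h$ (graded),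 and $(R_{X,h})_0$ is its degree-zero part. $J_b\otimes_{R_X}R_{X,h}$ is regarded as the extension of $J_b$ to $R_{X,h}$. Multiplication maps: for $g\in R_{d,0}$, let $\bar m_g:(R/I)_{a,b}\to(R/I)_{a+d,b}$, $[f]\mapsto[gf]$. The map $\bar m_{h^d}$ is invertible for every $d\ge0$. For $g'=g/h^d\in(R_{X,h})_0$ with $g$ homogeneous of degree $d$, $m_{g'}:=\bar m_{h^d}^{-1}\circ\bar m_g$, an endomorphism of $(R/I)_{a,b}$ independent of the chosen representative of $g'$. $k[m_{g'}:g'\in(R_{X,h})_0]$ is the $k$-subalgebra of $\mathrm{End}_k((R/I)_{a,b})$ generated by these maps, which is commutative; $g'\mapsto m_{g'}$ is a ring homomorphism. *)

theory Defs
  imports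
    "HOL-Algebra.Generated_Rings"
    "HOL-Algebra.Ideal_Product"
    "HOL-Algebra.QuotRing"
    "HOL-Library.Poly_Mapping"
    "Jordan_Normal_Form.VS_Connect"
begin

hide_const (open) Multiset.mult Polynomial.smult Modules.module

text \<open>
  Polynomials over \<open>'k\<close> in the variables \<open>x\<^sub>i\<close> (\<open>i :: 'n\<close>) and \<open>y\<^sub>j\<close> (\<open>j :: 'm\<close>): finitely
  supported maps from exponent vectors to coefficients, where \<open>Inl i\<close> stands for \<open>x\<^sub>i\<close> and
  \<open>Inr j\<close> for \<open>y\<^sub>j\<close>. With finite (automatically nonempty) index types of sizes \<open>n + 1\<close> and
  \<open>m + 1\<close> this is \<open>k[x\<^sub>0,\<dots>,x\<^sub>n,y\<^sub>0,\<dots>,y\<^sub>m]\<close>.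
\<close>

type_synonym ('n, 'm, 'k) bpoly = "('n + 'm \<Rightarrow>\<^sub>0 nat) \<Rightarrow>\<^sub>0 'k"

abbreviation polyR :: "('n, 'm, 'k::field) bpoly ring"
  where "polyR \<equiv> class_ring"

definition xdeg :: "('n::finite + 'm::finite \<Rightarrow>\<^sub>0 nat) \<Rightarrow> nat"
  where "xdeg t = (\<Sum>i\<in>UNIV. Poly_Mapping.lookup t (Inl i))"

definition ydeg :: "('n::finite + 'm::finite \<Rightarrow>\<^sub>0 nat) \<Rightarrow> nat"
  where "ydeg t = (\<Sum>j\<in>UNIV. Poly_Mapping.lookup t (Inr j))"

text \<open>
  The component \<open>R\<^bsub>a,b\<^esub>\<close>. As usual it contains \<open>0\<close>. Components in which a degree is negative
  are zero, so natural number degrees suffice.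
\<close>

definition bicomp :: "nat \<Rightarrow> nat \<Rightarrow> ('n::finite, 'm::finite, 'k::field) bpoly set"
  where "bicomp a b = {f. \<forall>t\<in>Poly_Mapping.keys f. xdeg t = a \<and> ydeg t = b}"

text \<open>\<open>R\<^sub>X\<close> as a subring of \<open>R\<close>.\<close>

definition polyRX :: "('n::finite, 'm::finite, 'k::field) bpoly ring"
  where "polyRX = polyR\<lparr>carrier := {f. \<forall>t\<in>Poly_Mapping.keys f. ydeg t = 0}\<rparr>"

definition my :: "('n::finite, 'm::finite, 'k::field) bpoly set"
  where "my = Idl\<^bsub>polyR\<^esub> (range (\<lambda>j. Poly_Mapping.single (Poly_Mapping.single (Inr j) 1) 1))"

definition bihomogeneous_ideal :: "('n::finite, 'm::finite, 'k::field) bpoly set \<Rightarrow> bool"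
  where "bihomogeneous_ideal I \<longleftrightarrow>
    ideal I polyR \<and> (\<exists>G \<subseteq> (\<Union>a b. bicomp a b). I = Idl\<^bsub>polyR\<^esub> G)"

definition generated_upto :: "('n::finite, 'm::finite, 'k::field) bpoly set \<Rightarrow> nat \<Rightarrow> nat \<Rightarrow> bool"
  where "generated_upto I a b \<longleftrightarrow>
    (\<exists>G \<subseteq> (\<Union>a'\<in>{..a}. \<Union>b'\<in>{..b}. bicomp a' b'). I = Idl\<^bsub>polyR\<^esub> G)"

text \<open>
  The \<open>k\<close>-vector space \<open>(R/I)\<^bsub>a,b\<^esub>\<close>, consisting of the cosets of the elements of \<open>R\<^bsub>a,b\<^esub>\<close>.
  The scalar \<open>c\<close> acts as the class of the constant polynomial \<open>c\<close>. (The fields \<open>mult\<close> and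
  \<open>one\<close> of a module record play no role.)
\<close>

definition quot_comp ::
    "('n::finite, 'm::finite, 'k::field) bpoly set \<Rightarrow> nat \<Rightarrow> nat \<Rightarrow> ('k, ('n, 'm, 'k) bpoly set) module"
  where "quot_comp I a b =
    \<lparr>carrier = (\<lambda>f. I +>\<^bsub>polyR\<^esub> f) ` bicomp a b,
     mult = mult (polyR Quot I), one = one (polyR Quot I),
     zero = zero (polyR Quot I), add = add (polyR Quot I),
     smult = (\<lambda>c A. (I +>\<^bsub>polyR\<^esub> Poly_Mapping.single 0 c) \<otimes>\<^bsub>polyR Quot I\<^esub> A)\<rparr>"

definition HF :: "('n::finite, 'm::finite, 'k::field) bpoly set \<Rightarrow> nat \<Rightarrow> nat \<Rightarrow> nat"
  where "HF I a b = vectorspace.dim (class_ring :: 'k ring) (quot_comp I a b)"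

definition admissible_form ::
    "('n::finite, 'm::finite, 'k::field) bpoly set \<Rightarrow> nat \<Rightarrow> nat \<Rightarrow> ('n, 'm, 'k) bpoly \<Rightarrow> bool"
  where "admissible_form I a b h \<longleftrightarrow>
    h \<in> bicomp 1 0 \<and> HF I a b = HF I (a + 1) b \<and> HF (Idl\<^bsub>polyR\<^esub> (I \<union> {h})) a b = 0"

definition admissible :: "('n::finite, 'm::finite, 'k::field) bpoly set \<Rightarrow> nat \<Rightarrow> nat \<Rightarrow> bool"
  where "admissible I a b \<longleftrightarrow> generated_upto I a b \<and> (\<exists>h. admissible_form I a b h)"

definition colon_ideal :: "('a, 'c) ring_scheme \<Rightarrow> 'a set \<Rightarrow> 'a set \<Rightarrow> 'a set"
  where "colon_ideal A I K = {f \<in> carrier A. \<forall>g\<in>K. f \<otimes>\<^bsub>A\<^esub> g \<in> I}"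

definition Jb :: "('n::finite, 'm::finite, 'k::field) bpoly set \<Rightarrow> nat \<Rightarrow> ('n, 'm, 'k) bpoly set"
  where "Jb I b = colon_ideal polyR I (my [^]\<^bsub>ideals_set polyR\<^esub> b) \<inter> carrier polyRX"

text \<open>
  Localization of a commutative ring \<open>A\<close> at a multiplicative set \<open>S\<close>: fractions \<open>r/s\<close> and
  \<open>r'/s'\<close> agree iff \<open>u (s' r - s r') = 0\<close> for some \<open>u \<in> S\<close>. The operations are given by
  representatives; the unions below are over identical classes.
\<close>

definition loc_rel :: "('a, 'c) ring_scheme \<Rightarrow> 'a set \<Rightarrow> (('a \<times> 'a) \<times> ('a \<times> 'a)) set"
  where "loc_rel A S = {((r, s), (r', s')).
    r \<in> carrier A \<and> r' \<in> carrier A \<and> s \<in> S \<and> s' \<in> S \<and>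
    (\<exists>u\<in>S. u \<otimes>\<^bsub>A\<^esub> (s' \<otimes>\<^bsub>A\<^esub> r \<ominus>\<^bsub>A\<^esub> s \<otimes>\<^bsub>A\<^esub> r') = \<zero>\<^bsub>A\<^esub>)}"

definition loc_frac :: "('a, 'c) ring_scheme \<Rightarrow> 'a set \<Rightarrow> 'a \<Rightarrow> 'a \<Rightarrow> ('a \<times> 'a) set"
  where "loc_frac A S r s = loc_rel A S `` {(r, s)}"

definition loc_ring :: "('a, 'c) ring_scheme \<Rightarrow> 'a set \<Rightarrow> ('a \<times> 'a) set ring"
  where "loc_ring A S =
    \<lparr>carrier = (carrier A \<times> S) // loc_rel A S,
     mult = (\<lambda>X Y. \<Union>(r, s)\<in>X. \<Union>(r', s')\<in>Y. loc_frac A S (r \<otimes>\<^bsub>A\<^esub> r') (s \<otimes>\<^bsub>A\<^esub> s')),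
     one = loc_frac A S \<one>\<^bsub>A\<^esub> \<one>\<^bsub>A\<^esub>,
     zero = loc_frac A S \<zero>\<^bsub>A\<^esub> \<one>\<^bsub>A\<^esub>,
     add = (\<lambda>X Y. \<Union>(r, s)\<in>X. \<Union>(r', s')\<in>Y.
       loc_frac A S (s' \<otimes>\<^bsub>A\<^esub> r \<oplus>\<^bsub>A\<^esub> s \<otimes>\<^bsub>A\<^esub> r') (s \<otimes>\<^bsub>A\<^esub> s'))\<rparr>"

text \<open>\<open>R\<^bsub>X,h\<^esub>\<close>, its fractions \<open>g/h\<^sup>d\<close>, and its degree-zero part.\<close>

definition RXh ::
    "('n::finite, 'm::finite, 'k::field) bpoly \<Rightarrow> (('n, 'm, 'k) bpoly \<times> ('n, 'm, 'k) bpoly) set ring"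
  where "RXh h = loc_ring polyRX (range (\<lambda>d. h ^ d))"

definition frac_h ::
    "('n::finite, 'm::finite, 'k::field) bpoly \<Rightarrow> ('n, 'm, 'k) bpoly \<Rightarrow> nat \<Rightarrow>
     (('n, 'm, 'k) bpoly \<times> ('n, 'm, 'k) bpoly) set"
  where "frac_h h g d = loc_frac polyRX (range (\<lambda>d. h ^ d)) g (h ^ d)"

definition RXh0 ::
    "('n::finite, 'm::finite, 'k::field) bpoly \<Rightarrow> (('n, 'm, 'k) bpoly \<times> ('n, 'm, 'k) bpoly) set ring"
  where "RXh0 h = (RXh h)\<lparr>carrier := {frac_h h g d |g d. g \<in> bicomp d 0}\<rparr>"

text \<open>The degree-zero part of the extension of an ideal \<open>J\<close> of \<open>R\<^sub>X\<close> to \<open>R\<^bsub>X,h\<^esub>\<close>.\<close>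

definition loc_ideal0 ::
    "('n::finite, 'm::finite, 'k::field) bpoly \<Rightarrow> ('n, 'm, 'k) bpoly set \<Rightarrow>
     (('n, 'm, 'k) bpoly \<times> ('n, 'm, 'k) bpoly) set set"
  where "loc_ideal0 h J = Idl\<^bsub>RXh h\<^esub> ((\<lambda>f. frac_h h f 0) ` J) \<inter> carrier (RXh0 h)"

text \<open>
  Endomorphisms are represented by functions that are undefined outside the carrier, so that
  equality of functions is equality of endomorphisms.
\<close>

definition End_ring :: "('a, 'c) ring_scheme \<Rightarrow> ('a, 'v, 'd) module_scheme \<Rightarrow> ('v \<Rightarrow> 'v) ring"
  where "End_ring K M =
    \<lparr>carrier = module_hom K M M \<inter> extensional (carrier M),
     mult = compose (carrier M),
     one = (\<lambda>v\<in>carrier M. v),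
     zero = (\<lambda>v\<in>carrier M. \<zero>\<^bsub>M\<^esub>),
     add = (\<lambda>\<phi> \<psi>. \<lambda>v\<in>carrier M. \<phi> v \<oplus>\<^bsub>M\<^esub> \<psi> v)\<rparr>"

text \<open>\<open>mbar I a b g\<close> is multiplication by \<open>g\<close> on \<open>(R/I)\<^bsub>a,b\<^esub>\<close>.\<close>

definition mbar ::
    "('n::finite, 'm::finite, 'k::field) bpoly set \<Rightarrow> nat \<Rightarrow> nat \<Rightarrow> ('n, 'm, 'k) bpoly \<Rightarrow>
     (('n, 'm, 'k) bpoly set \<Rightarrow> ('n, 'm, 'k) bpoly set)"
  where "mbar I a b g =
    (\<lambda>A\<in>carrier (quot_comp I a b). (I +>\<^bsub>polyR\<^esub> g) \<otimes>\<^bsub>polyR Quot I\<^esub> A)"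

text \<open>
  \<open>m\<^bsub>g'\<^esub>\<close>: the common value of \<open>mbar(h\<^sup>d)\<^sup>-\<^sup>1 \<circ> mbar(g)\<close> over all representations
  \<open>g' = g/h\<^sup>d\<close> with \<open>g\<close> homogeneous of degree \<open>d\<close>.
\<close>

definition mfrac ::
    "('n::finite, 'm::finite, 'k::field) bpoly set \<Rightarrow> nat \<Rightarrow> nat \<Rightarrow> ('n, 'm, 'k) bpoly \<Rightarrow>
     (('n, 'm, 'k) bpoly \<times> ('n, 'm, 'k) bpoly) set \<Rightarrow>
     (('n, 'm, 'k) bpoly set \<Rightarrow> ('n, 'm, 'k) bpoly set)"
  where "mfrac I a b h g' = the_elem
    {compose (carrier (quot_comp I a b))
       (inv_into (carrier (quot_comp I a b)) (mbar I a b (h ^ d))) (mbar I a b g)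
     |g d. g \<in> bicomp d 0 \<and> g' = frac_h h g d}"

text \<open>
  \<open>k[m\<^bsub>g'\<^esub> : g' \<in> (R\<^bsub>X,h\<^esub>)\<^sub>0]\<close>: the subring of the endomorphism ring generated by the scalars
  and the \<open>m\<^bsub>g'\<^esub>\<close>.
\<close>

definition mult_algebra ::
    "('n::finite, 'm::finite, 'k::field) bpoly set \<Rightarrow> nat \<Rightarrow> nat \<Rightarrow> ('n, 'm, 'k) bpoly \<Rightarrow>
     (('n, 'm, 'k) bpoly set \<Rightarrow> ('n, 'm, 'k) bpoly set) ring"
  where "mult_algebra I a b h =
    (let M = quot_comp I a b; E = End_ring (class_ring :: 'k ring) M in
     E\<lparr>carrier := generate_ring E
         (range (\<lambda>c. \<lambda>v\<in>carrier M. c \<odot>\<^bsub>M\<^esub> v) \<union> mfrac I a b h ` carrier (RXh0 h))\<rparr>)"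

end

theory Submission
  imports Defs
begin

text \<open>
  Write \<open>M\<^bsub>c\<^esub> = (R/I)\<^bsub>c,b\<^esub>\<close> and let \<open>g' = g/h\<^sup>d\<close> with \<open>g\<close> homogeneous of degree \<open>d\<close>. Both sides of the
  theorem describe the condition \<open>g R\<^bsub>a,b\<^esub> \<subseteq> I\<close> on \<open>g\<close>, and the key input is that
  multiplication by \<open>h\<close> is a bijection \<open>M\<^bsub>c\<^esub> \<rightarrow> M\<^bsub>c+1\<^esub>\<close> for every \<open>c \<ge> a\<close>.

  Given these bijections, \<open>m\<^bsub>g'\<^esub>\<close> sends \<open>[f]\<close> to the unique \<open>[w]\<close> with \<open>[g f] = [h\<^sup>d w]\<close>, so it is zero iff \<open>g\<close>
  kills \<open>M\<^bsub>a\<^esub>\<close>. If \<open>g\<close> kills \<open>M\<^bsub>a\<^esub>\<close>, then \<open>h\<^sup>a g\<close> kills every monomial of bidegree \<open>(0,b)\<close> modulo \<open>I\<close>, hence lies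
  in \<open>J\<^sub>b\<close>, and \<open>g' = (h\<^sup>a g)/h\<^sup>d\<^sup>+\<^sup>a\<close> lies in the extended ideal. Conversely, an element of the extended ideal is a single
  fraction \<open>f/h\<^sup>e\<close> with \<open>f \<in> J\<^sub>b\<close>; if it equals \<open>g'\<close>, a power of \<open>h\<close> times \<open>g\<close> kills \<open>M\<^bsub>a\<^esub>\<close>, and powers
  of \<open>h\<close> can be cancelled.

  The bijections are the substance of the proof. The condition \<open>HF\<^bsub>R/(I,h)\<^esub>(a,b) = 0\<close> says that \<open>M\<^bsub>a-1\<^esub> \<rightarrow> M\<^bsub>a\<^esub>\<close> is
  surjective (and \<open>M\<^bsub>a\<^esub> = 0\<close> if \<open>a = 0\<close>), and surjectivity is inherited by all later degrees, as \<open>R\<^bsub>c+1,b\<^esub>\<close> is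
  spanned by the products \<open>x\<^sub>i u\<close>. The equality \<open>HF\<^bsub>R/I\<^esub>(a,b) = HF\<^bsub>R/I\<^esub>(a+1,b)\<close> then makes \<open>M\<^bsub>a\<^esub> \<rightarrow> M\<^bsub>a+1\<^esub>\<close>
  injective by rank and nullity. That injectivity persists in higher degrees is a Gotzmann-type phenomenon, and it needs that \<open>I\<close> is
  generated in bidegrees \<open>\<le> (a,b)\<close>, so that \<open>I\<^bsub>c+1,b\<^esub> = \<Sum>\<^sub>i x\<^sub>i I\<^bsub>c,b\<^esub>\<close> for \<open>c \<ge> a\<close>. Once division by \<open>h\<close> is known to be
  well defined as a map \<open>M\<^bsub>c\<^esub> \<rightarrow> M\<^bsub>c-1\<^esub>\<close>, one defines it in the next degree on monomials by \<open>x\<^sub>i w \<mapsto> x\<^sub>i (w/h)\<close>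
  (lemma \<open>division_on_monomials\<close>). The linear extension maps \<open>h f\<close> to \<open>f\<close> and \<open>I\<^bsub>c+1,b\<^esub>\<close> into \<open>I\<close>, so \<open>h f \<in> I\<close>
  implies \<open>f \<in> I\<close> (lemma \<open>injectivity_extends_to_next_degree\<close>).
\<close>

section \<open>Bigraded polynomials and bihomogeneous ideals\<close>

lemma xdeg_zero [simp]: "xdeg 0 = 0" and ydeg_zero [simp]: "ydeg 0 = 0"
  by (simp_all add: xdeg_def ydeg_def)

lemma xdeg_add [simp]: "xdeg (s + t) = xdeg s + xdeg t"
  and ydeg_add [simp]: "ydeg (s + t) = ydeg s + ydeg t"
  by (simp_all add: xdeg_def ydeg_def lookup_add sum.distrib)

abbreviation xvar :: "'n \<Rightarrow> ('n::finite + 'm::finite \<Rightarrow>\<^sub>0 nat)"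
  where "xvar i \<equiv> Poly_Mapping.single (Inl i) 1"

abbreviation yvar :: "'m \<Rightarrow> ('n::finite + 'm::finite \<Rightarrow>\<^sub>0 nat)"
  where "yvar j \<equiv> Poly_Mapping.single (Inr j) 1"

(* the variants with Suc 0 are needed because the simplifier rewrites 1 :: nat *)
lemma deg_var [simp]:
  "xdeg (xvar i) = 1" "ydeg (xvar i) = 0" "xdeg (yvar j) = 0" "ydeg (yvar j) = 1"
  "xdeg (Poly_Mapping.single (Inl i) (Suc 0)) = 1" "ydeg (Poly_Mapping.single (Inl i) (Suc 0)) = 0"
  "xdeg (Poly_Mapping.single (Inr j) (Suc 0)) = 0" "ydeg (Poly_Mapping.single (Inr j) (Suc 0)) = 1"
  by (simp_all add: xdeg_def ydeg_def lookup_single when_def)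

lemma split_off_variable:
  assumes "Poly_Mapping.lookup t v > (0::nat)"
  obtains s where "t = Poly_Mapping.single v 1 + s"
proof
  show "t = Poly_Mapping.single v 1 + (t - Poly_Mapping.single v 1)"
    using assms by (intro poly_mapping_eqI) (auto simp: lookup_add lookup_minus lookup_single when_def)
qed

lemma xdeg_pos_split:
  assumes "xdeg t > 0"
  obtains i s where "t = xvar i + s"
proof -
  have "\<not> (\<forall>i. Poly_Mapping.lookup t (Inl i) = 0)"
  proof
    assume "\<forall>i. Poly_Mapping.lookup t (Inl i) = 0"
    then have "xdeg t = 0" by (simp add: xdeg_def)
    with assms show False by simp
  qed
  then obtain i where "Poly_Mapping.lookup t (Inl i) > 0" by auto
  then obtain s where "t = Poly_Mapping.single (Inl i) 1 + s" by (rule split_off_variable)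
  then show thesis by (rule that)
qed

lemma ydeg_pos_split:
  assumes "ydeg t > 0"
  obtains j s where "t = yvar j + s"
proof -
  have "\<not> (\<forall>i. Poly_Mapping.lookup t (Inr i) = 0)"
  proof
    assume "\<forall>i. Poly_Mapping.lookup t (Inr i) = 0"
    then have "ydeg t = 0" by (simp add: ydeg_def)
    with assms show False by simp
  qed
  then obtain i where "Poly_Mapping.lookup t (Inr i) > 0" by auto
  then obtain s where "t = Poly_Mapping.single (Inr i) 1 + s" by (rule split_off_variable)
  then show thesis by (rule that)
qed

text \<open>
  A monomial of positive \<open>x\<close>-degree can be written as \<open>x\<^sub>i w\<close> in several ways; any two of them come from a common refinement
  \<open>x\<^sub>i x\<^sub>j z\<close>. This replaces the Koszul relations between the variables.
\<close>

lemma xvar_add_eq_cases: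
  assumes "xvar i + w = xvar j + w'"
  obtains "i = j" "w = w'" | z where "w = xvar j + z" "w' = xvar i + z"
proof (cases "i = j")
  case True
  with assms that show thesis by auto
next
  case False
  have "Poly_Mapping.lookup (xvar i + w) (Inl j) = Poly_Mapping.lookup (xvar j + w') (Inl j)"
    using assms by simp
  then have "Poly_Mapping.lookup w (Inl j) > 0"
    using False by (simp add: lookup_add lookup_single)
  then obtain z where z: "w = xvar j + z" by (rule split_off_variable)
  from assms have "xvar j + w' = xvar j + (xvar i + z)" unfolding z by (simp add: ac_simps)
  then have "w' = xvar i + z" by simp
  with z that show thesis by blast
qed

lemma sum_of_terms:
  "f = (\<Sum>t\<in>Poly_Mapping.keys f. Poly_Mapping.single t (Poly_Mapping.lookup f t))"
  by (intro poly_mapping_eqI)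
    (auto simp: lookup_sum lookup_single when_def in_keys_iff sum.delta)

lemma poly_term_induct [case_names zero add single]:
  fixes f :: "'a \<Rightarrow>\<^sub>0 'b::comm_monoid_add"
  assumes "P 0" "\<And>f g. P f \<Longrightarrow> P g \<Longrightarrow> P (f + g)"
    and "\<And>t c. t \<in> Poly_Mapping.keys f \<Longrightarrow> P (Poly_Mapping.single t c)"
  shows "P f"
proof -
  have "P (\<Sum>t\<in>T. Poly_Mapping.single t (Poly_Mapping.lookup f t))"
    if "T \<subseteq> Poly_Mapping.keys f" "finite T" for T
    using that(2,1) by (induction T rule: finite_induct) (auto intro: assms)
  then show ?thesis using sum_of_terms[of f] by (metis finite_keys order_refl)
qed

lemma bicomp_zero [simp]: "0 \<in> bicomp a b"
  by (simp add: bicomp_def)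

lemma bicomp_add: "f \<in> bicomp a b \<Longrightarrow> g \<in> bicomp a b \<Longrightarrow> f + g \<in> bicomp a b"
  unfolding bicomp_def using Poly_Mapping.keys_add[of f g] by blast

lemma bicomp_uminus: "f \<in> bicomp a b \<Longrightarrow> - f \<in> bicomp a b"
  by (simp add: bicomp_def in_keys_iff)

lemma bicomp_diff: "f \<in> bicomp a b \<Longrightarrow> g \<in> bicomp a b \<Longrightarrow> f - g \<in> bicomp a b"
  using bicomp_add[of f a b "- g"] bicomp_uminus by auto

lemma bicomp_mult:
  assumes "f \<in> bicomp a b" "g \<in> bicomp a' b'"
  shows "f * g \<in> bicomp (a + a') (b + b')"
  using assms Poly_Mapping.keys_mult[of f g] unfolding bicomp_def by fastforce

lemma bicomp_single: "xdeg t = a \<Longrightarrow> ydeg t = b \<Longrightarrow> Poly_Mapping.single t c \<in> bicomp a b"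
  by (simp add: bicomp_def)

lemma bicomp_one: "1 \<in> bicomp 0 0"
  by (simp add: bicomp_def)

lemma bicomp_power: "h \<in> bicomp 1 0 \<Longrightarrow> h ^ d \<in> bicomp d 0"
proof (induction d)
  case (Suc d)
  then show ?case using bicomp_mult[of h 1 0 "h ^ d" d 0] by simp
qed (simp add: bicomp_one)

lemma bicomp_induct [consumes 1, case_names zero add single]:
  assumes "f \<in> bicomp a b" "P 0" "\<And>f g. P f \<Longrightarrow> P g \<Longrightarrow> P (f + g)"
    and "\<And>t c. xdeg t = a \<Longrightarrow> ydeg t = b \<Longrightarrow> P (Poly_Mapping.single t c)"
  shows "P f"
  by (rule poly_term_induct) (use assms in \<open>auto simp: bicomp_def\<close>)

definition bipart :: "nat \<Rightarrow> nat \<Rightarrow> ('n::finite, 'm::finite, 'k::field) bpoly \<Rightarrow> ('n, 'm, 'k) bpoly"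
  where "bipart a b f =
    (\<Sum>t | t \<in> Poly_Mapping.keys f \<and> xdeg t = a \<and> ydeg t = b.
      Poly_Mapping.single t (Poly_Mapping.lookup f t))"

lemma lookup_bipart:
  "Poly_Mapping.lookup (bipart a b f) t =
    (if xdeg t = a \<and> ydeg t = b then Poly_Mapping.lookup f t else 0)"
  unfolding bipart_def
  by (auto simp: lookup_sum lookup_single when_def in_keys_iff sum.delta)

lemma bipart_in_bicomp: "bipart a b f \<in> bicomp a b"
  by (auto simp: bicomp_def in_keys_iff lookup_bipart split: if_splits)

lemma bipart_add: "bipart a b (f + g) = bipart a b f + bipart a b g"
  by (intro poly_mapping_eqI) (simp add: lookup_bipart lookup_add)

lemma bipart_zero [simp]: "bipart a b 0 = 0"
  by (simp add: bipart_def)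

lemma bipart_same: "f \<in> bicomp a b \<Longrightarrow> bipart a b f = f"
  by (intro poly_mapping_eqI) (auto simp: lookup_bipart bicomp_def in_keys_iff)

lemma bipart_other:
  assumes "f \<in> bicomp a' b'" "(a', b') \<noteq> (a, b)"
  shows "bipart a b f = 0"
  by (rule poly_mapping_eqI)
    (use assms in \<open>auto simp: lookup_bipart bicomp_def in_keys_iff\<close>)

lemma bipart_diff: "bipart a b (f - g) = bipart a b f - bipart a b g"
  by (intro poly_mapping_eqI) (simp add: lookup_bipart lookup_minus)

lemma bipart_mult_left:
  assumes "g \<in> bicomp d e"
  shows "bipart (d + a) (e + b) (g * f) = g * bipart a b f"
proof (induction f rule: poly_term_induct)
  case (single t c)
  have *: "g * Poly_Mapping.single t c \<in> bicomp (d + xdeg t) (e + ydeg t)"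
    using assms by (intro bicomp_mult bicomp_single) auto
  show ?case
  proof (cases "xdeg t = a \<and> ydeg t = b")
    case True
    then show ?thesis using * by (simp add: bipart_same bicomp_single)
  next
    case False
    then have "bipart a b (Poly_Mapping.single t c) = 0"
      by (intro bipart_other[OF bicomp_single]) auto
    then show ?thesis using False by (auto intro: bipart_other[OF *])
  qed
qed (simp_all add: bipart_add distrib_left)

lemma bipart_mult_left_zero:
  assumes "g \<in> bicomp d e" "a < d"
  shows "bipart a b (g * f) = 0"
proof (induction f rule: poly_term_induct)
  case (single t c)
  have *: "g * Poly_Mapping.single t c \<in> bicomp (d + xdeg t) (e + ydeg t)"
    using assms by (intro bicomp_mult bicomp_single) auto
  then show ?case using assms(2) by (intro bipart_other[OF *]) auto
qed (simp_all add: bipart_add distrib_left)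

lemma polyR_idealI:
  assumes "0 \<in> K" "\<And>f g. f \<in> K \<Longrightarrow> g \<in> K \<Longrightarrow> f + g \<in> K" "\<And>r f. f \<in> K \<Longrightarrow> r * f \<in> K"
  shows "ideal K (polyR :: ('n, 'm, 'k::field) bpoly ring)"
proof (rule idealI)
  show "ring (polyR :: ('n, 'm, 'k) bpoly ring)" by (rule class_ring.ring_axioms)
  show "subgroup K (add_monoid polyR)"
  proof (rule subgroup.intro)
    fix f assume f: "f \<in> K"
    have "- f \<in> K" using assms(3)[OF f, of "-1"] by simp
    moreover have "inv\<^bsub>add_monoid polyR\<^esub> f = - f"
      using class_ring_simps(8)[where 'a = "('n, 'm, 'k) bpoly"] by (metis a_inv_def)
    ultimately show "inv\<^bsub>add_monoid polyR\<^esub> f \<in> K" by simp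
  qed (use assms in auto)
qed (use assms in \<open>auto simp: mult.commute\<close>)

lemma polyR_idealD:
  assumes "ideal I (polyR :: ('n, 'm, 'k::field) bpoly ring)"
  shows "0 \<in> I" "f \<in> I \<Longrightarrow> g \<in> I \<Longrightarrow> f + g \<in> I" "f \<in> I \<Longrightarrow> r * f \<in> I"
    "f \<in> I \<Longrightarrow> f * r \<in> I" "f \<in> I \<Longrightarrow> g \<in> I \<Longrightarrow> f - g \<in> I"
proof -
  interpret I: ideal I "polyR :: ('n, 'm, 'k) bpoly ring" by fact
  show "0 \<in> I" using I.zero_closed by simp
  show add: "f + g \<in> I" if "f \<in> I" "g \<in> I" for f g using I.a_closed[OF that] by simp
  show mult: "r * f \<in> I" if "f \<in> I" for r f using I.I_l_closed[OF that] by simp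
  show "f * r \<in> I" if "f \<in> I" using mult[OF that, of r] by (simp add: mult.commute)
  show "f - g \<in> I" if "f \<in> I" "g \<in> I" using add[OF that(1) mult[OF that(2), of "-1"]] by simp
qed

lemma polyR_genideal: "ideal (Idl\<^bsub>polyR\<^esub> G) (polyR :: ('n, 'm, 'k::field) bpoly ring)"
  by (rule ring.genideal_ideal[OF class_ring.ring_axioms]) simp

lemma polyR_genideal_minimal:
  "ideal K (polyR :: ('n, 'm, 'k::field) bpoly ring) \<Longrightarrow> G \<subseteq> K \<Longrightarrow> Idl\<^bsub>polyR\<^esub> G \<subseteq> K"
  by (rule ring.genideal_minimal[OF class_ring.ring_axioms])

lemma polyR_genideal_self: "G \<subseteq> Idl\<^bsub>(polyR :: ('n, 'm, 'k::field) bpoly ring)\<^esub> G"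
  by (rule ring.genideal_self[OF class_ring.ring_axioms]) simp

text \<open>
  An element of the ideal is a combination \<open>\<Sum>\<^sub>i q\<^sub>i g\<^sub>i\<close> of bihomogeneous generators, and its component of bidegree \<open>(a,b)\<close>
  collects those terms \<open>t g\<^sub>i\<close>, \<open>t\<close> a term of \<open>q\<^sub>i\<close>, which have that bidegree themselves. The set \<open>L\<close> is a parameter so
  that finer information on these terms, such as divisibility by a variable, carries over to the component.
\<close>

lemma bipart_of_bihomogeneous_ideal:
  fixes G :: "('n::finite, 'm::finite, 'k::field) bpoly set"
  assumes G: "\<And>g. g \<in> G \<Longrightarrow> \<exists>a' b'. g \<in> bicomp a' b'"
    and p: "p \<in> Idl\<^bsub>polyR\<^esub> G"
    and L: "0 \<in> L" "\<And>f g. f \<in> L \<Longrightarrow> g \<in> L \<Longrightarrow> f + g \<in> L"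
    and L_single: "\<And>t c g. g \<in> G \<Longrightarrow> Poly_Mapping.single t c * g \<in> bicomp a b \<Longrightarrow>
      Poly_Mapping.single t c * g \<in> L"
  shows "bipart a b p \<in> L"
proof -
  \<comment> \<open>quantifying over all multiples makes this set an ideal\<close>
  let ?K = "{p. \<forall>q. bipart a b (q * p) \<in> L}"
  have "ideal ?K (polyR :: ('n, 'm, 'k) bpoly ring)"
    by (rule polyR_idealI) (use L in \<open>auto simp: bipart_add distrib_left mult.assoc[symmetric]\<close>)
  moreover have "G \<subseteq> ?K"
  proof safe
    fix g q assume g: "g \<in> G"
    then obtain a' b' where ab: "g \<in> bicomp a' b'" using G by blast
    show "bipart a b (q * g) \<in> L"
    proof (induction q rule: poly_term_induct)
      case (single t c)
      have *: "Poly_Mapping.single t c * g \<in> bicomp (xdeg t + a') (ydeg t + b')"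
        using ab by (intro bicomp_mult bicomp_single) auto
      show ?case
      proof (cases "(xdeg t + a', ydeg t + b') = (a, b)")
        case True
        then show ?thesis using * L_single[OF g] by (auto simp: bipart_same)
      next
        case False
        then show ?thesis using bipart_other[OF *] L by metis
      qed
    qed (use L in \<open>auto simp: bipart_add distrib_right\<close>)
  qed
  ultimately have "p \<in> ?K" using p polyR_genideal_minimal by blast
  then have "bipart a b (1 * p) \<in> L" by blast
  then show ?thesis by simp
qed

lemma bihomogeneous_ideal_bipart:
  assumes "bihomogeneous_ideal I" "p \<in> I"
  shows "bipart a b p \<in> I"
proof -
  from assms(1) obtain G where G: "G \<subseteq> (\<Union>a b. bicomp a b)" "I = Idl\<^bsub>polyR\<^esub> G"
    and I: "ideal I polyR"
    unfolding bihomogeneous_ideal_def by blast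
  have "\<exists>a' b'. g \<in> bicomp a' b'" if "g \<in> G" for g using G(1) that by blast
  then show ?thesis
    by (rule bipart_of_bihomogeneous_ideal[of G])
      (use G(1) assms(2) polyR_idealD[OF I] polyR_genideal_self[of G] in \<open>auto simp flip: G(2)\<close>)
qed

text \<open>
  This is \<open>I\<^bsub>c+1,b'\<^esub> = \<Sum>\<^sub>i x\<^sub>i I\<^bsub>c,b'\<^esub>\<close> for \<open>c \<ge> a\<close>: a multiple \<open>t g\<close> of a generator whose \<open>x\<close>-degree exceeds that of
  \<open>g\<close> contains a variable \<open>x\<^sub>i\<close> in the cofactor \<open>t\<close>.
\<close>

lemma generated_upto_induct [consumes 4, case_names zero add var]:
  fixes I :: "('n::finite, 'm::finite, 'k::field) bpoly set"
  assumes gen: "generated_upto I a b" and c: "a \<le> c" and f: "f \<in> I" "f \<in> bicomp (Suc c) b'"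
    and P: "P 0" "\<And>f g. P f \<Longrightarrow> P g \<Longrightarrow> P (f + g)"
    and P_var: "\<And>i u. u \<in> I \<Longrightarrow> u \<in> bicomp c b' \<Longrightarrow> P (Poly_Mapping.single (xvar i) 1 * u)"
  shows "P f"
proof -
  from gen obtain G where G: "G \<subseteq> (\<Union>a'\<in>{..a}. \<Union>b'\<in>{..b}. bicomp a' b')" "I = Idl\<^bsub>polyR\<^esub> G"
    unfolding generated_upto_def by blast
  have I: "ideal I polyR" unfolding G(2) by (rule polyR_genideal)
  have G': "\<exists>a' b'. g \<in> bicomp a' b'" if "g \<in> G" for g using G(1) that by blast
  have "bipart (Suc c) b' f \<in> Collect P"
  proof (rule bipart_of_bihomogeneous_ideal[of G])
    fix t k g assume g: "g \<in> G" and deg: "Poly_Mapping.single t k * g \<in> bicomp (Suc c) b'"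
    from g G obtain a1 b1 where ab: "a1 \<le> a" "g \<in> bicomp a1 b1" by blast
    have gI: "g \<in> I" using g polyR_genideal_self[of G] unfolding G(2) by blast
    show "Poly_Mapping.single t k * g \<in> Collect P"
    proof (cases "Poly_Mapping.single t k * g = 0")
      case True
      then show ?thesis using P by simp
    next
      case False
      have "Poly_Mapping.single t k * g \<in> bicomp (xdeg t + a1) (ydeg t + b1)"
        using ab by (intro bicomp_mult bicomp_single) auto
      then have "(xdeg t + a1, ydeg t + b1) = (Suc c, b')"
        using False bipart_other bipart_same[OF deg] by metis
      then have eq: "Suc c = xdeg t + a1" "b' = ydeg t + b1" by simp_all
      with ab c have "xdeg t > 0" by linarith
      then obtain i s where t: "t = xvar i + s" by (rule xdeg_pos_split)
      have "Poly_Mapping.single s k * g \<in> bicomp c b'"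
        using bicomp_mult[OF bicomp_single ab(2), of s "xdeg s" "ydeg s" k] eq t by simp
      moreover have "Poly_Mapping.single s k * g \<in> I" using polyR_idealD(3)[OF I gI] .
      ultimately have "P (Poly_Mapping.single (xvar i) 1 * (Poly_Mapping.single s k * g))"
        using P_var by blast
      then show ?thesis unfolding t by (simp add: mult_single mult.assoc[symmetric])
    qed
  qed (use G(2) G' f P in auto)
  then show ?thesis using f by (simp add: bipart_same)
qed

section \<open>Division by a linear form in high degrees\<close>

definition linear_extension :: "('a \<Rightarrow> ('v::monoid_add \<Rightarrow>\<^sub>0 'k::comm_ring_1)) \<Rightarrow> ('a \<Rightarrow>\<^sub>0 'k) \<Rightarrow> ('v \<Rightarrow>\<^sub>0 'k)"
  where "linear_extension \<phi> f =
    (\<Sum>t\<in>Poly_Mapping.keys f. Poly_Mapping.single 0 (Poly_Mapping.lookup f t) * \<phi> t)"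

lemma linear_extension_superset:
  assumes "finite T" "Poly_Mapping.keys f \<subseteq> T"
  shows "linear_extension \<phi> f = (\<Sum>t\<in>T. Poly_Mapping.single 0 (Poly_Mapping.lookup f t) * \<phi> t)"
  unfolding linear_extension_def
  by (rule sum.mono_neutral_left) (use assms in \<open>auto simp: in_keys_iff\<close>)

lemma linear_extension_add: "linear_extension \<phi> (f + g) = linear_extension \<phi> f + linear_extension \<phi> g"
proof -
  let ?T = "Poly_Mapping.keys f \<union> Poly_Mapping.keys g"
  have "Poly_Mapping.keys (f + g) \<subseteq> ?T" by (rule Poly_Mapping.keys_add)
  then show ?thesis
    by (simp add: linear_extension_superset[of ?T] lookup_add single_add distrib_right sum.distrib)
qed

lemma linear_extension_zero [simp]: "linear_extension \<phi> 0 = 0"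
  by (simp add: linear_extension_def)

lemma linear_extension_single [simp]:
  "linear_extension \<phi> (Poly_Mapping.single t c) = Poly_Mapping.single 0 c * \<phi> t"
  by (simp add: linear_extension_def)

lemma linear_form_induct [consumes 1, case_names zero add var]:
  assumes "h \<in> bicomp 1 0" "P 0" "\<And>f g. P f \<Longrightarrow> P g \<Longrightarrow> P (f + g)"
    and P_var: "\<And>i c. P (Poly_Mapping.single (xvar i) c)"
  shows "P h"
  using assms(1)
proof (induction rule: bicomp_induct)
  case (single t c)
  then have "xdeg t > 0" by simp
  then obtain i s where t: "t = xvar i + s" by (rule xdeg_pos_split)
  have "Poly_Mapping.lookup s v = 0" for v
  proof (cases v)
    case (Inl j)
    have "(\<Sum>j\<in>UNIV. Poly_Mapping.lookup s (Inl j)) = 0"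
      using single t by (simp flip: xdeg_def)
    then show ?thesis using Inl by simp
  next
    case (Inr j)
    have "(\<Sum>j\<in>UNIV. Poly_Mapping.lookup s (Inr j)) = 0"
      using single t by (simp flip: ydeg_def)
    then show ?thesis using Inr by simp
  qed
  then have "s = 0" by (intro poly_mapping_eqI) simp
  then show ?case using t P_var by simp
qed (use assms in auto)

text \<open>
  \<open>R\<^bsub>c+2,b\<^esub>\<close> is spanned by the products \<open>x\<^sub>i u\<close>, and if \<open>u \<equiv> h w\<close> then \<open>x\<^sub>i u \<equiv> h (x\<^sub>i w)\<close>.
\<close>

lemma division_extends_to_next_degree:
  assumes I: "ideal I polyR" and h: "h \<in> bicomp 1 0"
    and div: "\<And>f. f \<in> bicomp (Suc c) b \<Longrightarrow> \<exists>w\<in>bicomp c b. f - h * w \<in> I"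
    and f: "f \<in> bicomp (Suc (Suc c)) b"
  shows "\<exists>w\<in>bicomp (Suc c) b. f - h * w \<in> I"
  using f
proof (induction rule: bicomp_induct)
  case zero
  then show ?case using polyR_idealD(1)[OF I] by (intro bexI[of _ 0]) auto
next
  case (add f g)
  then obtain v w where "v \<in> bicomp (Suc c) b" "w \<in> bicomp (Suc c) b"
    "f - h * v \<in> I" "g - h * w \<in> I" by blast
  then show ?case
    using polyR_idealD(2)[OF I, of "f - h * v" "g - h * w"]
    by (intro bexI[of _ "v + w"]) (auto simp: algebra_simps bicomp_add)
next
  case (single t k)
  then obtain i s where t: "t = xvar i + s" using xdeg_pos_split[of t] by auto
  obtain w where w: "w \<in> bicomp c b" "Poly_Mapping.single s k - h * w \<in> I"
    using div[of "Poly_Mapping.single s k"] bicomp_single[of s "Suc c" b] single t by auto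
  have "Poly_Mapping.single (xvar i) 1 * (Poly_Mapping.single s k - h * w) \<in> I"
    using w(2) by (rule polyR_idealD(3)[OF I])
  moreover have "Poly_Mapping.single (xvar i) 1 * w \<in> bicomp (Suc c) b"
    using bicomp_mult[OF bicomp_single w(1), of "xvar i" 1 0] by simp
  moreover have "Poly_Mapping.single (xvar i) 1 * (Poly_Mapping.single s k - h * w)
    = Poly_Mapping.single t k - h * (Poly_Mapping.single (xvar i) 1 * w)"
    unfolding t by (simp add: right_diff_distrib mult_single mult.left_commute)
  ultimately show ?case by metis
qed

text \<open>
  In degree \<open>c + 3\<close> the quotient of \<open>t = x\<^sub>i w\<close> by \<open>h\<close> should be \<open>x\<^sub>i v\<close> with \<open>h v \<equiv> w\<close> modulo \<open>I\<close>. The class of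
  \<open>x\<^sub>i v\<close> does not depend on the choices. For a fixed \<open>i\<close> this is injectivity one degree lower. If
  \<open>t = x\<^sub>i w = x\<^sub>j w'\<close> with \<open>i \<noteq> j\<close>, then \<open>w = x\<^sub>j z\<close> and \<open>w' = x\<^sub>i z\<close>; writing \<open>z \<equiv> h q\<close>, injectivity gives
  \<open>v \<equiv> x\<^sub>j q\<close> and \<open>v' \<equiv> x\<^sub>i q\<close>, so both quotients are \<open>x\<^sub>i x\<^sub>j q\<close>. The element \<open>q\<close> lives two degrees below the
  quotients, which is why surjectivity has to start one degree before injectivity.
\<close>

lemma division_on_monomials:
  fixes I :: "('n::finite, 'm::finite, 'k::field) bpoly set"
  assumes I: "ideal I polyR"
    and div: "\<And>c' f. c \<le> c' \<Longrightarrow> f \<in> bicomp (Suc c') b \<Longrightarrow> \<exists>w\<in>bicomp c' b. f - h * w \<in> I"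
    and inj: "\<And>w. w \<in> bicomp (Suc c) b \<Longrightarrow> h * w \<in> I \<Longrightarrow> w \<in> I"
    and t: "xdeg t = Suc (Suc (Suc c))" "ydeg t = b"
  shows "\<exists>s. \<forall>i w v. t = xvar i + w \<longrightarrow> v \<in> bicomp (Suc c) b \<longrightarrow>
    Poly_Mapping.single w 1 - h * v \<in> I \<longrightarrow> s - Poly_Mapping.single (xvar i) 1 * v \<in> I"
proof -
  let ?X = "\<lambda>i. Poly_Mapping.single (xvar i) 1 :: ('n, 'm, 'k) bpoly"
  let ?M = "\<lambda>w. Poly_Mapping.single w 1 :: ('n, 'm, 'k) bpoly"
  obtain i w where iw: "t = xvar i + w" using xdeg_pos_split[of t] t by auto
  obtain v where v: "v \<in> bicomp (Suc c) b" "?M w - h * v \<in> I"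
    using div[of "Suc c" "?M w"] bicomp_single[of w "Suc (Suc c)" b] t iw by auto
  have "?X i * v - ?X j * v' \<in> I"
    if jw: "t = xvar j + w'" and v': "v' \<in> bicomp (Suc c) b" "?M w' - h * v' \<in> I" for j w' v'
  proof -
    have "xvar i + w = xvar j + w'" using iw jw by simp
    then show ?thesis
    proof (cases rule: xvar_add_eq_cases)
      case 1
      have "h * (v - v') = (?M w' - h * v') - (?M w - h * v)"
        using 1 by (simp add: algebra_simps)
      then have "v - v' \<in> I"
        using v v' inj[of "v - v'"] polyR_idealD(5)[OF I] bicomp_diff by metis
      then have "?X i * (v - v') \<in> I" by (rule polyR_idealD(3)[OF I])
      then show ?thesis using 1 by (simp add: algebra_simps)
    next
      case (2 z)
      obtain q where q: "q \<in> bicomp c b" "?M z - h * q \<in> I"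
        using div[of c "?M z"] bicomp_single[of z "Suc c" b] t iw 2 by auto
      have Xq: "?X l * q \<in> bicomp (Suc c) b" for l
        using bicomp_mult[OF bicomp_single q(1), of "xvar l" 1 0] by simp
      have "h * (v - ?X j * q) = ?X j * (?M z - h * q) - (?M w - h * v)"
        unfolding 2 by (simp add: algebra_simps mult_single)
      then have "v - ?X j * q \<in> I"
        using v q Xq inj[of "v - ?X j * q"] polyR_idealD(3,5)[OF I] bicomp_diff by metis
      moreover have "h * (v' - ?X i * q) = ?X i * (?M z - h * q) - (?M w' - h * v')"
        unfolding 2 by (simp add: algebra_simps mult_single)
      then have "v' - ?X i * q \<in> I"
        using v' q Xq inj[of "v' - ?X i * q"] polyR_idealD(3,5)[OF I] bicomp_diff by metis
      ultimately have "?X i * (v - ?X j * q) - ?X j * (v' - ?X i * q) \<in> I"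
        using polyR_idealD(3,5)[OF I] by blast
      then show ?thesis by (simp add: algebra_simps)
    qed
  qed
  then show ?thesis by blast
qed

text \<open>
  The division \<open>\<sigma>\<close> of degree \<open>c + 3\<close> by \<open>h\<close>, defined on monomials by the previous lemma, satisfies
  \<open>\<sigma> (x\<^sub>i u) \<equiv> x\<^sub>i v\<close> whenever \<open>h v \<equiv> u\<close>. For \<open>u \<in> I\<close> one has \<open>v \<in> I\<close> by injectivity in the previous degree, so
  \<open>\<sigma>\<close> maps \<open>\<Sum>\<^sub>i x\<^sub>i I\<^bsub>c+2,b\<^esub> = I\<^bsub>c+3,b\<^esub>\<close> into \<open>I\<close>. For \<open>u = f\<close>, summing over the terms of \<open>h\<close> gives
  \<open>\<sigma> (h f) \<equiv> h v \<equiv> f\<close>. Hence \<open>h f \<in> I\<close> forces \<open>f \<in> I\<close>.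
\<close>

lemma injectivity_extends_to_next_degree:
  fixes I :: "('n::finite, 'm::finite, 'k::field) bpoly set"
  assumes I: "ideal I polyR" and h: "h \<in> bicomp 1 0"
    and div: "\<And>c' f. c \<le> c' \<Longrightarrow> f \<in> bicomp (Suc c') b \<Longrightarrow> \<exists>w\<in>bicomp c' b. f - h * w \<in> I"
    and inj: "\<And>w. w \<in> bicomp (Suc c) b \<Longrightarrow> h * w \<in> I \<Longrightarrow> w \<in> I"
    and gen: "generated_upto I a b" "a \<le> Suc (Suc c)"
    and f: "f \<in> bicomp (Suc (Suc c)) b" "h * f \<in> I"
  shows "f \<in> I"
proof -
  let ?X = "\<lambda>i. Poly_Mapping.single (xvar i) 1 :: ('n, 'm, 'k) bpoly"
  let ?C = "\<lambda>k. Poly_Mapping.single 0 k :: ('n, 'm, 'k) bpoly"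
  note ID = polyR_idealD[OF I]
  obtain \<phi> where \<phi>: "\<And>t i w v. xdeg t = Suc (Suc (Suc c)) \<Longrightarrow> ydeg t = b \<Longrightarrow> t = xvar i + w \<Longrightarrow>
      v \<in> bicomp (Suc c) b \<Longrightarrow> Poly_Mapping.single w 1 - h * v \<in> I \<Longrightarrow> \<phi> t - ?X i * v \<in> I"
    using division_on_monomials[OF I div inj] by metis
  define \<sigma> where "\<sigma> = linear_extension \<phi>"
  have \<sigma>_add: "\<sigma> (u + u') = \<sigma> u + \<sigma> u'" for u u'
    by (simp add: \<sigma>_def linear_extension_add)
  have inj': "v - v' \<in> I"
    if "u - h * v \<in> I" "u - h * v' \<in> I" "v \<in> bicomp (Suc c) b" "v' \<in> bicomp (Suc c) b" for u v v'
  proof (rule inj)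
    have "h * (v - v') = (u - h * v') - (u - h * v)" by (simp add: algebra_simps)
    then show "h * (v - v') \<in> I" using ID(5)[OF that(2,1)] by simp
  qed (use that bicomp_diff in auto)
  \<comment> \<open>the terms of \<open>u\<close> determine some \<open>v\<close>; by injectivity the statement then holds for every quotient \<open>v\<close>\<close>
  have \<sigma>_ex: "\<exists>v\<in>bicomp (Suc c) b. u - h * v \<in> I \<and> \<sigma> (?X i * u) - ?X i * v \<in> I"
    if "u \<in> bicomp (Suc (Suc c)) b" for u i
    using that
  proof (induction rule: bicomp_induct)
    case zero
    then show ?case using ID(1) by (intro bexI[of _ 0]) (auto simp: \<sigma>_def)
  next
    case (add u u')
    then obtain v v' where v: "v \<in> bicomp (Suc c) b" "v' \<in> bicomp (Suc c) b"
      "u - h * v \<in> I" "u' - h * v' \<in> I"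
      "\<sigma> (?X i * u) - ?X i * v \<in> I" "\<sigma> (?X i * u') - ?X i * v' \<in> I" by blast
    show ?case
      using ID(2)[OF v(3,4)] ID(2)[OF v(5,6)] v(1,2)
      by (intro bexI[of _ "v + v'"]) (auto simp: bicomp_add algebra_simps \<sigma>_add)
  next
    case (single w k)
    obtain v where v: "v \<in> bicomp (Suc c) b" "Poly_Mapping.single w 1 - h * v \<in> I"
      using div[of "Suc c" "Poly_Mapping.single w 1"] bicomp_single[OF single] by auto
    have *: "\<phi> (xvar i + w) - ?X i * v \<in> I"
      by (rule \<phi>[OF _ _ refl v]) (use single in auto)
    have "?C k * (Poly_Mapping.single w 1 - h * v) = Poly_Mapping.single w k - h * (?C k * v)"
      by (simp add: right_diff_distrib mult_single ac_simps)
    moreover have "?C k * (\<phi> (xvar i + w) - ?X i * v)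
      = \<sigma> (?X i * Poly_Mapping.single w k) - ?X i * (?C k * v)"
      by (simp add: right_diff_distrib mult_single \<sigma>_def mult.left_commute)
    moreover have "?C k * v \<in> bicomp (Suc c) b"
      using bicomp_mult[OF bicomp_single v(1), of 0 0 0] by simp
    ultimately show ?case
      using ID(3)[OF v(2), of "?C k"] ID(3)[OF *, of "?C k"] by (intro bexI[of _ "?C k * v"]) auto
  qed
  have \<sigma>_var: "\<sigma> (?X i * u) - ?X i * v \<in> I"
    if u: "u \<in> bicomp (Suc (Suc c)) b" and v: "v \<in> bicomp (Suc c) b" "u - h * v \<in> I" for u i v
  proof -
    obtain v' where v': "v' \<in> bicomp (Suc c) b" "u - h * v' \<in> I" "\<sigma> (?X i * u) - ?X i * v' \<in> I"
      using \<sigma>_ex[OF u] by blast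
    have "?X i * (v' - v) \<in> I" using inj'[OF v'(2) v(2) v'(1) v(1)] by (rule ID(3))
    from ID(2)[OF v'(3) this] show ?thesis by (simp add: algebra_simps)
  qed
  have "h * f \<in> bicomp (Suc (Suc (Suc c))) b"
    using bicomp_mult[OF h f(1)] by simp
  with gen f(2) have "\<sigma> (h * f) \<in> I"
  proof (induction rule: generated_upto_induct)
    case (var i u)
    then obtain v where v: "v \<in> bicomp (Suc c) b" "u - h * v \<in> I"
      using \<sigma>_ex by blast
    have "h * v \<in> I" using ID(5)[OF var(1) v(2)] by simp
    then have "v \<in> I" using inj v by blast
    then show ?case using ID(2)[OF \<sigma>_var[OF var(2) v, of i] ID(3)[of v "?X i"]] by simp
  qed (use ID in \<open>auto simp: \<sigma>_add\<close>, simp add: \<sigma>_def)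
  moreover
  obtain v where v: "v \<in> bicomp (Suc c) b" "f - h * v \<in> I"
    using div[OF _ f(1)] by auto
  have "\<sigma> (h * f) - h * v \<in> I"
    using h
  proof (induction rule: linear_form_induct)
    case zero
    then show ?case using ID(1) by (simp add: \<sigma>_def)
  next
    case (add g g')
    show ?case using ID(2)[OF add] by (simp add: \<sigma>_add algebra_simps)
  next
    case (var i k)
    have "?C k * f \<in> bicomp (Suc (Suc c)) b" "?C k * v \<in> bicomp (Suc c) b"
      using bicomp_mult[OF bicomp_single f(1), of 0 0 0] bicomp_mult[OF bicomp_single v(1), of 0 0 0]
      by simp_all
    moreover have "?C k * f - h * (?C k * v) \<in> I"
      using ID(3)[OF v(2), of "?C k"] by (simp add: algebra_simps)
    ultimately have "\<sigma> (?X i * (?C k * f)) - ?X i * (?C k * v) \<in> I"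
      by (rule \<sigma>_var)
    then show ?case by (simp add: mult.assoc[symmetric] mult_single)
  qed
  ultimately have "\<sigma> (h * f) - (\<sigma> (h * f) - h * v) + (f - h * v) \<in> I"
    using v(2) ID(2,5) by blast
  then show ?thesis by simp
qed

lemma division_persists:
  assumes I: "ideal I polyR" and h: "h \<in> bicomp 1 0"
    and div: "\<And>f. f \<in> bicomp (Suc a) b \<Longrightarrow> \<exists>w\<in>bicomp a b. f - h * w \<in> I"
    and c: "a \<le> c" and f: "f \<in> bicomp (Suc c) b"
  shows "\<exists>w\<in>bicomp c b. f - h * w \<in> I"
  using c f
proof (induction c arbitrary: f rule: dec_induct)
  case base
  then show ?case by (rule div)
next
  case (step c)
  show ?case by (rule division_extends_to_next_degree[OF I h step.IH step.prems])
qed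

lemma injectivity_persists:
  fixes I :: "('n::finite, 'm::finite, 'k::field) bpoly set"
  assumes I: "ideal I polyR" and h: "h \<in> bicomp 1 0" and gen: "generated_upto I (Suc a) b"
    and div: "\<And>f. f \<in> bicomp (Suc a) b \<Longrightarrow> \<exists>w\<in>bicomp a b. f - h * w \<in> I"
    and inj: "\<And>w. w \<in> bicomp (Suc a) b \<Longrightarrow> h * w \<in> I \<Longrightarrow> w \<in> I"
    and c: "a \<le> c" and w: "w \<in> bicomp (Suc c) b" "h * w \<in> I"
  shows "w \<in> I"
  using c w
proof (induction c arbitrary: w rule: dec_induct)
  case base
  then show ?case using inj by blast
next
  case (step c)
  show ?case
  proof (rule injectivity_extends_to_next_degree[OF I h _ _ gen])
    show "\<exists>w\<in>bicomp c' b. f - h * w \<in> I" if "c \<le> c'" "f \<in> bicomp (Suc c') b" for c' f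
      by (rule division_persists[OF I h div _ that(2)]) (use that step.hyps in auto)
    show "v \<in> I" if "v \<in> bicomp (Suc c) b" "h * v \<in> I" for v
      using that by (rule step.IH)
    show "Suc a \<le> Suc (Suc c)" using step.hyps by simp
  qed (fact step.prems)+
qed

section \<open>Hilbert functions and multiplication by an admissible form\<close>

lemma (in vectorspace) dim_zero_imp_trivial:
  assumes "fin_dim" "dim = 0"
  shows "carrier V = {\<zero>\<^bsub>V\<^esub>}"
proof -
  obtain B where B: "finite B" "basis B" using finite_basis_exists[OF assms(1)] by blast
  with dim_basis[of B] assms(2) have "B = {}" by simp
  then have "span {} = carrier V" using B by (simp add: basis_def)
  then show ?thesis by (simp add: span_empty)
qed

text \<open>
  Rank and nullity give \<open>dim (ker T) = 0\<close>, where \<open>dim\<close> is the least size of a finite generating set. To conclude, one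
  needs to know that the kernel has some finite generating set at all; a maximal independent subset of the kernel is one.
\<close>

lemma (in linear_map) trivial_kernel_if_surj_and_dim_eq:
  assumes fd: "V.fin_dim" and surj: "T ` carrier V = carrier W" and dim: "V.dim = W.dim"
  shows "kerT = {\<zero>\<^bsub>V\<^esub>}"
proof -
  interpret Ker: vectorspace K "V.vs kerT"
    using kerT_is_subspace by (rule V.subspace_is_vs)
  have ker_V: "kerT \<subseteq> carrier V" by (auto simp: ker_def)
  have subm: "submodule K kerT V" using kerT_is_subspace by (simp add: subspace_def)
  have "V.module.lin_indpt S \<and> finite S \<and> card S \<le> V.dim" if "S \<subseteq> kerT \<and> Ker.lin_indpt S" for S
  proof -
    have "V.module.lin_indpt S" using that V.module.span_li_not_depend(2)[OF _ subm, of S] by simp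
    then show ?thesis using V.li_le_dim[OF fd, of S] that ker_V by auto
  qed
  moreover have "{} \<subseteq> kerT \<and> Ker.lin_indpt {}" by (simp add: Ker.lin_dep_def)
  ultimately obtain B where B: "finite B" "maximal B (\<lambda>S. S \<subseteq> kerT \<and> Ker.lin_indpt S)"
    using maximal_exists[of "\<lambda>S. S \<subseteq> kerT \<and> Ker.lin_indpt S" V.dim "{}"] by blast
  have "Ker.basis B" by (rule Ker.max_li_is_basis) (use B in simp)
  then have "Ker.fin_dim" using B(1) by (auto simp: Ker.fin_dim_def Ker.basis_def)
  moreover have "Ker.dim = 0"
    using rank_nullity[OF fd] surj_imp_imT_carrier[OF surj] dim by simp
  ultimately show ?thesis using Ker.dim_zero_imp_trivial by simp
qed

lemma polyR_rcos_hom: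
  assumes "ideal I (polyR :: ('n, 'm, 'k::field) bpoly ring)"
  shows "(I +>\<^bsub>polyR\<^esub> f) \<oplus>\<^bsub>polyR Quot I\<^esub> (I +>\<^bsub>polyR\<^esub> g) = I +>\<^bsub>polyR\<^esub> (f + g)"
    and "(I +>\<^bsub>polyR\<^esub> f) \<otimes>\<^bsub>polyR Quot I\<^esub> (I +>\<^bsub>polyR\<^esub> g) = I +>\<^bsub>polyR\<^esub> (f * g)"
  using ring_hom_add[OF ideal.rcos_ring_hom[OF assms], of f g]
    ring_hom_mult[OF ideal.rcos_ring_hom[OF assms], of f g] by simp_all

lemma polyR_rcos_eq_iff:
  assumes "ideal I (polyR :: ('n, 'm, 'k::field) bpoly ring)"
  shows "I +>\<^bsub>polyR\<^esub> f = I +>\<^bsub>polyR\<^esub> g \<longleftrightarrow> f - g \<in> I"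
proof -
  note ID = polyR_idealD[OF assms]
  have *: "I +>\<^bsub>polyR\<^esub> f = {i + f |i. i \<in> I}" for f
    by (auto simp: a_r_coset_def')
  show ?thesis
  proof
    assume "I +>\<^bsub>polyR\<^esub> f = I +>\<^bsub>polyR\<^esub> g"
    then have "f \<in> {i + g |i. i \<in> I}" using ID(1) unfolding * by force
    then show "f - g \<in> I" by auto
  next
    assume fg: "f - g \<in> I"
    have "\<exists>j\<in>I. i + f = j + g" "\<exists>j\<in>I. i + g = j + f" if "i \<in> I" for i
      using ID(2)[OF that fg] ID(5)[OF that fg]
      by (auto intro: bexI[of _ "i + (f - g)"] bexI[of _ "i - (f - g)"])
    then show "I +>\<^bsub>polyR\<^esub> f = I +>\<^bsub>polyR\<^esub> g" unfolding * by blast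
  qed
qed

lemma polyR_rcos_zero:
  assumes "ideal I (polyR :: ('n, 'm, 'k::field) bpoly ring)"
  shows "I +>\<^bsub>polyR\<^esub> 0 = I"
  by (auto simp: a_r_coset_def')

lemma quot_comp_simps:
  fixes I :: "('n::finite, 'm::finite, 'k::field) bpoly set"
  assumes I: "ideal I polyR"
  shows "carrier (quot_comp I a b) = (\<lambda>f. I +>\<^bsub>polyR\<^esub> f) ` bicomp a b"
    and "\<zero>\<^bsub>quot_comp I a b\<^esub> = I +>\<^bsub>polyR\<^esub> 0"
    and "(I +>\<^bsub>polyR\<^esub> f) \<oplus>\<^bsub>quot_comp I a b\<^esub> (I +>\<^bsub>polyR\<^esub> g) = I +>\<^bsub>polyR\<^esub> (f + g)"
    and "c \<odot>\<^bsub>quot_comp I a b\<^esub> (I +>\<^bsub>polyR\<^esub> f) = I +>\<^bsub>polyR\<^esub> (Poly_Mapping.single 0 c * f)"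
  using polyR_rcos_hom[OF I] polyR_rcos_zero[OF I]
  by (simp_all add: quot_comp_def FactRing_def)

lemma bicomp_scale: "f \<in> bicomp a b \<Longrightarrow> Poly_Mapping.single 0 c * f \<in> bicomp a b"
  using bicomp_mult[OF bicomp_single, of 0 0 0 f a b c] by simp

lemma quot_comp_vectorspace:
  fixes I :: "('n::finite, 'm::finite, 'k::field) bpoly set"
  assumes I: "ideal I polyR"
  shows "vectorspace (class_ring :: 'k ring) (quot_comp I a b)"
proof -
  note S = quot_comp_simps[OF I]
  have grp: "abelian_group (quot_comp I a b)"
  proof (rule abelian_groupI)
    fix x assume "x \<in> carrier (quot_comp I a b)"
    then obtain f where f: "f \<in> bicomp a b" "x = I +>\<^bsub>polyR\<^esub> f" by (auto simp: S)
    then show "\<exists>y\<in>carrier (quot_comp I a b). y \<oplus>\<^bsub>quot_comp I a b\<^esub> x = \<zero>\<^bsub>quot_comp I a b\<^esub>"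
      by (intro bexI[of _ "I +>\<^bsub>polyR\<^esub> (- f)"]) (auto simp: S bicomp_uminus)
  qed (auto simp: S bicomp_add ac_simps)
  have "module (class_ring :: 'k ring) (quot_comp I a b)"
    by (rule moduleI)
      (auto simp: S grp class_cring.cring_axioms bicomp_scale single_add distrib_left distrib_right
        mult_single mult.assoc[symmetric])
  then show ?thesis by (intro vectorspace.intro class_field)
qed

lemma lookup_le_total_degree: "Poly_Mapping.lookup t v \<le> xdeg t + ydeg t"
proof (cases v)
  case (Inl i)
  have "Poly_Mapping.lookup t (Inl i) \<le> xdeg t"
    unfolding xdeg_def by (rule member_le_sum) simp_all
  then show ?thesis using Inl by simp
next
  case (Inr j)
  have "Poly_Mapping.lookup t (Inr j) \<le> ydeg t"
    unfolding ydeg_def by (rule member_le_sum) simp_all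
  then show ?thesis using Inr by simp
qed

lemma finite_bidegree:
  "finite {t :: 'n::finite + 'm::finite \<Rightarrow>\<^sub>0 nat. xdeg t = a \<and> ydeg t = b}" (is "finite ?T")
proof (rule inj_on_finite)
  show "inj_on Poly_Mapping.lookup ?T"
    by (rule inj_onI) (simp only: poly_mapping_eq_iff)
  show "Poly_Mapping.lookup ` ?T \<subseteq> (UNIV \<rightarrow>\<^sub>E {..a + b})"
  proof
    fix f assume "f \<in> Poly_Mapping.lookup ` ?T"
    then obtain t where "xdeg t = a" "ydeg t = b" "f = Poly_Mapping.lookup t" by blast
    then have "f v \<le> a + b" for v using lookup_le_total_degree[of t v] by simp
    then show "f \<in> UNIV \<rightarrow>\<^sub>E {..a + b}" by (simp add: PiE_UNIV_domain)
  qed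
  show "finite (UNIV \<rightarrow>\<^sub>E {..a + b} :: ('n + 'm \<Rightarrow> nat) set)"
    by (rule finite_PiE) simp_all
qed

lemma quot_comp_fin_dim:
  fixes I :: "('n::finite, 'm::finite, 'k::field) bpoly set"
  assumes I: "ideal I polyR"
  shows "vectorspace.fin_dim (class_ring :: 'k ring) (quot_comp I a b)"
proof -
  interpret V: vectorspace "class_ring :: 'k ring" "quot_comp I a b"
    using I by (rule quot_comp_vectorspace)
  note S = quot_comp_simps[OF I]
  let ?B = "(\<lambda>t. I +>\<^bsub>polyR\<^esub> Poly_Mapping.single t 1) ` {t. xdeg t = a \<and> ydeg t = b}"
  have B: "?B \<subseteq> carrier (quot_comp I a b)" by (auto simp: S bicomp_single)
  interpret sub: submodule "class_ring :: 'k ring" "V.span ?B" "quot_comp I a b"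
    using B by (rule V.span_is_submodule)
  have "I +>\<^bsub>polyR\<^esub> f \<in> V.span ?B" if "f \<in> bicomp a b" for f
    using that
  proof (induction rule: bicomp_induct)
    case zero
    then show ?case using V.span_zero by (simp add: S)
  next
    case (add f g)
    then show ?case using sub.m_closed[of "I +>\<^bsub>polyR\<^esub> f" "I +>\<^bsub>polyR\<^esub> g"] by (simp add: S)
  next
    case (single t c)
    then have "I +>\<^bsub>polyR\<^esub> Poly_Mapping.single t 1 \<in> V.span ?B"
      by (intro V.span_mem[OF B]) auto
    then have "c \<odot>\<^bsub>quot_comp I a b\<^esub> (I +>\<^bsub>polyR\<^esub> Poly_Mapping.single t 1) \<in> V.span ?B"
      by (intro sub.smult_closed) auto
    then show ?case by (simp add: S mult_single)
  qed
  then have "carrier (quot_comp I a b) \<subseteq> V.span ?B" by (auto simp: S)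
  with V.span_is_subset2[OF B] have "V.gen_set ?B" by auto
  moreover have "finite ?B" using finite_bidegree by (rule finite_imageI)
  ultimately show ?thesis using B unfolding V.fin_dim_def by (intro exI[of _ ?B] conjI)
qed

lemma HF_zero_imp_bicomp_subset:
  assumes I: "ideal I polyR" and "HF I a b = 0"
  shows "bicomp a b \<subseteq> I"
proof
  fix f :: "('a::finite, 'b::finite, 'c::field) bpoly" assume f: "f \<in> bicomp a b"
  interpret V: vectorspace "class_ring :: 'c ring" "quot_comp I a b"
    using I by (rule quot_comp_vectorspace)
  have "carrier (quot_comp I a b) = {\<zero>\<^bsub>quot_comp I a b\<^esub>}"
    using V.dim_zero_imp_trivial quot_comp_fin_dim[OF I] assms(2) unfolding HF_def by blast
  then have "I +>\<^bsub>polyR\<^esub> f = I +>\<^bsub>polyR\<^esub> 0" using f by (auto simp: quot_comp_simps[OF I])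
  then show "f \<in> I" by (simp add: polyR_rcos_eq_iff[OF I])
qed

text \<open>
  By hypothesis \<open>div\<close> multiplication by \<open>h\<close> is a surjection \<open>(R/I)\<^bsub>a,b\<^esub> \<rightarrow> (R/I)\<^bsub>a+1,b\<^esub>\<close>, and both spaces have the same
  finite dimension.
\<close>

lemma HF_eq_imp_mult_injective:
  fixes I :: "('n::finite, 'm::finite, 'k::field) bpoly set"
  assumes I: "ideal I polyR" and h: "h \<in> bicomp 1 0" and HF: "HF I a b = HF I (Suc a) b"
    and div: "\<And>f. f \<in> bicomp (Suc a) b \<Longrightarrow> \<exists>w\<in>bicomp a b. f - h * w \<in> I"
    and w: "w \<in> bicomp a b" "h * w \<in> I"
  shows "w \<in> I"
proof -
  note S = quot_comp_simps[OF I]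
  define T where "T = (\<lambda>A. (I +>\<^bsub>polyR\<^esub> h) \<otimes>\<^bsub>polyR Quot I\<^esub> A)"
  have T: "T (I +>\<^bsub>polyR\<^esub> f) = I +>\<^bsub>polyR\<^esub> (h * f)" for f
    by (simp add: T_def polyR_rcos_hom[OF I])
  have hmult: "h * f \<in> bicomp (Suc a) b" if "f \<in> bicomp a b" for f
    using bicomp_mult[OF h that] by simp
  have "T \<in> module_hom class_ring (quot_comp I a b) (quot_comp I (Suc a) b)"
    using hmult by (auto simp: module_hom_def S T distrib_left mult.left_commute)
  then interpret T: linear_map "class_ring :: 'k ring" "quot_comp I a b" "quot_comp I (Suc a) b" T
    using quot_comp_vectorspace[OF I] 
    by (auto simp: linear_map_def mod_hom_def mod_hom_axioms_def vectorspace_def)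
  have "T ` carrier (quot_comp I a b) = carrier (quot_comp I (Suc a) b)"
  proof -
    have "I +>\<^bsub>polyR\<^esub> f \<in> T ` carrier (quot_comp I a b)" if f: "f \<in> bicomp (Suc a) b" for f
    proof -
      obtain w where "w \<in> bicomp a b" "f - h * w \<in> I" using div[OF f] by blast
      then have "I +>\<^bsub>polyR\<^esub> f = T (I +>\<^bsub>polyR\<^esub> w)" by (simp add: T polyR_rcos_eq_iff[OF I])
      then show ?thesis using \<open>w \<in> bicomp a b\<close> by (auto simp: S)
    qed
    then show ?thesis using hmult by (auto simp: S T)
  qed
  then have ker: "T.kerT = {\<zero>\<^bsub>quot_comp I a b\<^esub>}"
    using T.trivial_kernel_if_surj_and_dim_eq quot_comp_fin_dim[OF I] HF unfolding HF_def by blast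
  have "I +>\<^bsub>polyR\<^esub> w \<in> T.kerT"
    using w by (auto simp: T.ker_def S T polyR_rcos_eq_iff[OF I])
  then show ?thesis unfolding ker by (simp add: S polyR_rcos_eq_iff[OF I])
qed

text \<open>
  The condition \<open>HF\<^bsub>R/(I,h)\<^esub>(a,b) = 0\<close> puts \<open>R\<^bsub>a,b\<^esub>\<close> into \<open>I + h R\<close>. Taking components of bidegree \<open>(a,b)\<close> makes the cofactor
  of \<open>h\<close> bihomogeneous, and leaves none if \<open>a = 0\<close>.
\<close>

lemma admissible_form_division:
  fixes I :: "('n::finite, 'm::finite, 'k::field) bpoly set"
  assumes I: "bihomogeneous_ideal I" and h: "admissible_form I a b h" and f: "f \<in> bicomp a b"
  shows "a = 0 \<Longrightarrow> f \<in> I"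
    and "a = Suc c \<Longrightarrow> \<exists>w\<in>bicomp c b. f - h * w \<in> I"
proof -
  from I have ID: "ideal I polyR" by (simp add: bihomogeneous_ideal_def)
  note D = polyR_idealD[OF ID]
  have h1: "h \<in> bicomp 1 0" using h by (simp add: admissible_form_def)
  have "f \<in> Idl\<^bsub>polyR\<^esub> (I \<union> {h})"
    using HF_zero_imp_bicomp_subset[OF polyR_genideal] h f unfolding admissible_form_def by blast
  moreover have "ideal {p. \<exists>r. p - h * r \<in> I} (polyR :: ('n, 'm, 'k) bpoly ring)"
  proof (rule polyR_idealI; clarsimp)
    show "\<exists>r. - (h * r) \<in> I" using D(1) by (intro exI[of _ 0]) simp
    show "\<exists>q. f + g - h * q \<in> I" if "f - h * r \<in> I" "g - h * s \<in> I" for f g r s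
      using D(2)[OF that] by (intro exI[of _ "r + s"]) (simp add: algebra_simps)
    show "\<exists>q. s * f - h * q \<in> I" if "f - h * r \<in> I" for f r s
      using D(3)[OF that, of s] by (intro exI[of _ "s * r"]) (simp add: algebra_simps)
  qed
  moreover have "I \<union> {h} \<subseteq> {p. \<exists>r. p - h * r \<in> I}"
  proof safe
    show "\<exists>r. p - h * r \<in> I" if "p \<in> I" for p using that by (intro exI[of _ 0]) simp
    show "\<exists>r. h - h * r \<in> I" using D(1) by (intro exI[of _ 1]) simp
  qed
  ultimately obtain r where "f - h * r \<in> I" using polyR_genideal_minimal by blast
  then have part: "f - bipart a b (h * r) \<in> I"
    using bihomogeneous_ideal_bipart[OF I, of "f - h * r" a b] f
    by (simp add: bipart_diff bipart_same)
  show "f \<in> I" if "a = 0"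
    using part bipart_mult_left_zero[OF h1, of a b r] that by simp
  show "\<exists>w\<in>bicomp c b. f - h * w \<in> I" if "a = Suc c"
    using part bipart_mult_left[OF h1, of c b r] bipart_in_bicomp[of c b r] that by auto
qed

lemma bicomp_subset_ideal_persists:
  assumes I: "ideal I polyR" and sub: "bicomp a b \<subseteq> I" and c: "a \<le> c"
  shows "bicomp c b \<subseteq> I"
  using c
proof (induction c rule: dec_induct)
  case (step c)
  show ?case
  proof
    fix f :: "('a, 'b, 'c) bpoly" assume "f \<in> bicomp (Suc c) b"
    then show "f \<in> I"
    proof (induction rule: bicomp_induct)
      case (single t k)
      then have "xdeg t > 0" by simp
      then obtain i s where t: "t = xvar i + s" by (rule xdeg_pos_split)
      have "Poly_Mapping.single s k \<in> I"
        using step.IH bicomp_single[of s c b k] single t by auto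
      then have "Poly_Mapping.single (xvar i) 1 * Poly_Mapping.single s k \<in> I"
        by (rule polyR_idealD(3)[OF I])
      then show ?case unfolding t by (simp add: mult_single)
    qed (use polyR_idealD[OF I] in auto)
  qed
qed (fact sub)

text \<open>
  For \<open>a = 0\<close> the spaces \<open>(R/I)\<^bsub>c,b\<^esub>\<close> with \<open>c \<ge> a\<close> are all zero; for positive \<open>a\<close> the persistence lemmas apply with starting degree \<open>a - 1\<close>, where surjectivity begins.
\<close>

lemma admissible_form_bijective:
  fixes I :: "('n::finite, 'm::finite, 'k::field) bpoly set"
  assumes I: "bihomogeneous_ideal I" and gen: "generated_upto I a b"
    and h: "admissible_form I a b h" and c: "a \<le> c"
  shows "f \<in> bicomp (Suc c) b \<Longrightarrow> \<exists>w\<in>bicomp c b. f - h * w \<in> I"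
    and "w \<in> bicomp c b \<Longrightarrow> h * w \<in> I \<Longrightarrow> w \<in> I"
proof -
  from I have ID: "ideal I polyR" by (simp add: bihomogeneous_ideal_def)
  have h1: "h \<in> bicomp 1 0" and HF: "HF I a b = HF I (Suc a) b"
    using h by (simp_all add: admissible_form_def)
  have "(\<forall>f\<in>bicomp (Suc c) b. \<exists>w\<in>bicomp c b. f - h * w \<in> I) \<and>
    (\<forall>w\<in>bicomp c b. h * w \<in> I \<longrightarrow> w \<in> I)"
  proof (cases a)
    case 0
    then have "bicomp 0 b \<subseteq> I" using admissible_form_division(1)[OF I h] by blast
    then have "bicomp c b \<subseteq> I" "bicomp (Suc c) b \<subseteq> I"
      using bicomp_subset_ideal_persists[OF ID] by blast+
    then show ?thesis by (auto intro!: bexI[of _ 0])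
  next
    case (Suc a')
    have div: "\<exists>w\<in>bicomp c' b. f - h * w \<in> I" if "a' \<le> c'" "f \<in> bicomp (Suc c') b" for c' f
      by (rule division_persists[OF ID h1 _ that]) (use admissible_form_division(2)[OF I h] Suc in blast)
    have inj: "w \<in> I" if "w \<in> bicomp (Suc a') b" "h * w \<in> I" for w
      by (rule HF_eq_imp_mult_injective[OF ID h1 HF _ that[folded Suc]]) (use div Suc in auto)
    obtain c' where c': "c = Suc c'" "a' \<le> c'" using c Suc by (cases c) auto
    show ?thesis
      using div[of c] injectivity_persists[OF ID h1 gen[unfolded Suc] div inj c'(2)] c' by auto
  qed
  then show "f \<in> bicomp (Suc c) b \<Longrightarrow> \<exists>w\<in>bicomp c b. f - h * w \<in> I"
    and "w \<in> bicomp c b \<Longrightarrow> h * w \<in> I \<Longrightarrow> w \<in> I" by blast+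
qed

lemma admissible_form_power_bijective:
  fixes I :: "('n::finite, 'm::finite, 'k::field) bpoly set"
  assumes I: "bihomogeneous_ideal I" and gen: "generated_upto I a b"
    and h: "admissible_form I a b h" and c: "a \<le> c"
  shows "f \<in> bicomp (c + d) b \<Longrightarrow> \<exists>w\<in>bicomp c b. f - h ^ d * w \<in> I"
    and "w \<in> bicomp c b \<Longrightarrow> h ^ d * w \<in> I \<Longrightarrow> w \<in> I"
proof -
  from I have ID: "ideal I polyR" by (simp add: bihomogeneous_ideal_def)
  note D = polyR_idealD[OF ID]
  have h1: "h \<in> bicomp 1 0" using h by (simp add: admissible_form_def)
  show "\<exists>w\<in>bicomp c b. f - h ^ d * w \<in> I" if "f \<in> bicomp (c + d) b"
    using that
  proof (induction d arbitrary: f)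
    case 0
    then show ?case using D(1) by (intro bexI[of _ f]) auto
  next
    case (Suc d)
    then obtain v where v: "v \<in> bicomp (c + d) b" "f - h * v \<in> I"
      using admissible_form_bijective(1)[OF I gen h, of "c + d" f] c by auto
    obtain w where w: "w \<in> bicomp c b" "v - h ^ d * w \<in> I" using Suc.IH[OF v(1)] by blast
    have "f - h ^ Suc d * w = (f - h * v) + h * (v - h ^ d * w)" by (simp add: algebra_simps)
    then show ?case using D(2)[OF v(2) D(3)[OF w(2)]] w(1) by metis
  qed
  show "w \<in> I" if "w \<in> bicomp c b" "h ^ d * w \<in> I"
    using that(2)
  proof (induction d)
    case (Suc d)
    have "h ^ d * w \<in> bicomp (d + c) b"
      using bicomp_mult[OF bicomp_power[OF h1] that(1)] by simp
    then have "h ^ d * w \<in> I"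
      using admissible_form_bijective(2)[OF I gen h, of "d + c" "h ^ d * w"] c Suc.prems
      by (simp add: mult.assoc)
    then show ?case by (rule Suc.IH)
  qed simp
qed

section \<open>The localization at a linear form\<close>

definition RX :: "('n::finite, 'm::finite, 'k::field) bpoly set"
  where "RX = {f. \<forall>t\<in>Poly_Mapping.keys f. ydeg t = 0}"

lemma polyRX_simps:
  "carrier polyRX = RX" "mult polyRX = (*)" "add polyRX = (+)" "one polyRX = 1" "zero polyRX = 0"
  by (simp_all add: polyRX_def RX_def)

lemma RX_closed:
  "0 \<in> RX" "1 \<in> RX" "f \<in> RX \<Longrightarrow> g \<in> RX \<Longrightarrow> f + g \<in> RX" "f \<in> RX \<Longrightarrow> - f \<in> RX"
  "f \<in> RX \<Longrightarrow> g \<in> RX \<Longrightarrow> f * g \<in> RX" "f \<in> RX \<Longrightarrow> f ^ d \<in> RX"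
proof -
  show mult: "f * g \<in> RX" if "f \<in> RX" "g \<in> RX" for f g
    using that Poly_Mapping.keys_mult[of f g] unfolding RX_def by fastforce
  show one: "1 \<in> RX" by (simp add: RX_def)
  show "f ^ d \<in> RX" if "f \<in> RX" by (induction d) (use that mult one in simp_all)
  show "f + g \<in> RX" if "f \<in> RX" "g \<in> RX" using that Poly_Mapping.keys_add[of f g] unfolding RX_def by blast
qed (auto simp: in_keys_iff RX_def)

lemma bicomp_RX: "f \<in> bicomp d 0 \<Longrightarrow> f \<in> RX"
  by (simp add: bicomp_def RX_def)

lemma polyRX_a_minus:
  assumes "f \<in> RX" "g \<in> RX"
  shows "f \<ominus>\<^bsub>polyRX\<^esub> g = f - g"
proof -
  have "\<ominus>\<^bsub>polyRX\<^esub> g = - g"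
    unfolding a_inv_def m_inv_def
    by (rule the_equality)
      (use assms RX_closed(4) in \<open>auto simp: polyRX_simps eq_neg_iff_add_eq_0\<close>)
  then show ?thesis by (simp add: a_minus_def polyRX_simps)
qed

text \<open>
  The ring operations of a localization are unions over representatives. They are well defined once each pair of
  representatives contributes the same class.
\<close>

lemma UN_pairs_constant:
  assumes "X \<noteq> {}" "Y \<noteq> {}"
    and "\<And>r s r' s'. (r, s) \<in> X \<Longrightarrow> (r', s') \<in> Y \<Longrightarrow> F r s r' s' = C"
  shows "(\<Union>(r, s)\<in>X. \<Union>(r', s')\<in>Y. F r s r' s') = C"
  by (rule SUP_eq_const[OF assms(1)], clarify, rule SUP_eq_const[OF assms(2)], clarify)
    (rule assms(3))

context
  fixes h :: "('n::finite, 'm::finite, 'k::field) bpoly"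
  assumes h: "h \<in> RX"
begin

lemma RXh_rel_iff:
  assumes "g \<in> RX" "g' \<in> RX"
  shows "((g, h ^ d), (g', h ^ d')) \<in> loc_rel polyRX (range (\<lambda>d. h ^ d)) \<longleftrightarrow>
    (\<exists>u. h ^ (u + d') * g = h ^ (u + d) * g')"
proof -
  have "h ^ d' * g \<ominus>\<^bsub>polyRX\<^esub> h ^ d * g' = h ^ d' * g - h ^ d * g'"
    by (intro polyRX_a_minus RX_closed assms h)
  then show ?thesis
    using assms by (simp add: loc_rel_def polyRX_simps right_diff_distrib power_add mult.assoc)
qed

lemma RXh_rel_equiv: "equiv (RX \<times> range (\<lambda>d. h ^ d)) (loc_rel polyRX (range (\<lambda>d. h ^ d)))"
proof (rule equivI)
  let ?r = "loc_rel polyRX (range (\<lambda>d. h ^ d))"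
  show sub: "?r \<subseteq> (RX \<times> range (\<lambda>d. h ^ d)) \<times> (RX \<times> range (\<lambda>d. h ^ d))"
    by (auto simp: loc_rel_def polyRX_simps)
  show "refl_on (RX \<times> range (\<lambda>d. h ^ d)) ?r"
    by (rule refl_onI) (auto simp: RXh_rel_iff)
  show "sym ?r"
  proof (rule symI)
    fix x y assume xy: "(x, y) \<in> ?r"
    then obtain f d g e where "x = (f, h ^ d)" "y = (g, h ^ e)" "f \<in> RX" "g \<in> RX"
      using sub by blast
    with xy show "(y, x) \<in> ?r" by (simp add: RXh_rel_iff) metis
  qed
  show "trans ?r"
  proof (rule transI)
    fix x y z assume xyz: "(x, y) \<in> ?r" "(y, z) \<in> ?r"
    then obtain f d g e where xy: "x = (f, h ^ d)" "y = (g, h ^ e)" "f \<in> RX" "g \<in> RX"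
      using sub by blast
    moreover obtain k l where z: "z = (k, h ^ l)" "k \<in> RX"
      using sub xyz(2) by blast
    ultimately have eq: "x = (f, h ^ d)" "y = (g, h ^ e)" "z = (k, h ^ l)"
      and RX: "f \<in> RX" "g \<in> RX" "k \<in> RX" by blast+
    with xyz obtain u v where uv: "h ^ (u + e) * f = h ^ (u + d) * g" "h ^ (v + l) * g = h ^ (v + e) * k"
      by (auto simp: RXh_rel_iff)
    have "h ^ (u + v + e + l) * f = h ^ (v + l) * (h ^ (u + e) * f)" by (simp add: power_add ac_simps)
    also have "\<dots> = h ^ (u + d) * (h ^ (v + l) * g)" unfolding uv(1) by (simp add: ac_simps)
    also have "\<dots> = h ^ (u + v + e + d) * k" unfolding uv(2) by (simp add: power_add ac_simps)
    finally show "(x, z) \<in> ?r" using RX unfolding eq by (auto simp: RXh_rel_iff)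
  qed
qed

lemma frac_h_eq_iff:
  assumes "g \<in> RX" "g' \<in> RX"
  shows "frac_h h g d = frac_h h g' d' \<longleftrightarrow> (\<exists>u. h ^ (u + d') * g = h ^ (u + d) * g')"
  using eq_equiv_class_iff[OF RXh_rel_equiv, of "(g, h ^ d)" "(g', h ^ d')"] assms RXh_rel_iff
  by (simp add: frac_h_def loc_frac_def)

lemma frac_h_members:
  assumes "g \<in> RX"
  shows "(g, h ^ d) \<in> frac_h h g d"
    and "x \<in> frac_h h g d \<Longrightarrow> \<exists>g' d'. x = (g', h ^ d') \<and> g' \<in> RX \<and> (\<exists>u. h ^ (u + d') * g = h ^ (u + d) * g')"
proof -
  show "(g, h ^ d) \<in> frac_h h g d"
    using assms RXh_rel_iff[OF assms assms, of d d] by (simp add: frac_h_def loc_frac_def)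
  assume x: "x \<in> frac_h h g d"
  then have "((g, h ^ d), x) \<in> loc_rel polyRX (range (\<lambda>d. h ^ d))"
    by (simp add: frac_h_def loc_frac_def)
  moreover from this obtain g' d' where "x = (g', h ^ d')" "g' \<in> RX"
    by (cases x) (auto simp: loc_rel_def polyRX_simps)
  ultimately show "\<exists>g' d'. x = (g', h ^ d') \<and> g' \<in> RX \<and> (\<exists>u. h ^ (u + d') * g = h ^ (u + d) * g')"
    using RXh_rel_iff[OF assms] by blast
qed

lemma frac_h_mult:
  assumes "f \<in> RX" "g \<in> RX"
  shows "frac_h h f d \<otimes>\<^bsub>RXh h\<^esub> frac_h h g e = frac_h h (f * g) (d + e)"
proof -
  let ?F = "\<lambda>r s r' s'. loc_frac polyRX (range (\<lambda>d. h ^ d)) (r * r') (s * s')"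
  have *: "?F r s r' s' = frac_h h (f * g) (d + e)"
    if x: "(r, s) \<in> frac_h h f d" and y: "(r', s') \<in> frac_h h g e" for r s r' s'
  proof -
    obtain d' u where r: "s = h ^ d'" "r \<in> RX" "h ^ (u + d') * f = h ^ (u + d) * r"
      using frac_h_members(2)[OF assms(1) x] by blast
    obtain e' v where r': "s' = h ^ e'" "r' \<in> RX" "h ^ (v + e') * g = h ^ (v + e) * r'"
      using frac_h_members(2)[OF assms(2) y] by blast
    have "(h ^ (u + d) * r) * (h ^ (v + e) * r') = (h ^ (u + d') * f) * (h ^ (v + e') * g)"
      using r(3) r'(3) by simp
    then have "h ^ (u + v + (d + e)) * (r * r') = h ^ (u + v + (d' + e')) * (f * g)"
      by (simp add: power_add ac_simps)
    then have "frac_h h (r * r') (d' + e') = frac_h h (f * g) (d + e)"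
      by (intro frac_h_eq_iff[THEN iffD2] exI[of _ "u + v"] RX_closed assms r(2) r'(2)) simp
    then show ?thesis using r r' by (simp add: frac_h_def power_add)
  qed
  have "frac_h h f d \<otimes>\<^bsub>RXh h\<^esub> frac_h h g e =
    (\<Union>(r, s)\<in>frac_h h f d. \<Union>(r', s')\<in>frac_h h g e. ?F r s r' s')"
    by (simp add: RXh_def loc_ring_def polyRX_simps)
  also have "\<dots> = frac_h h (f * g) (d + e)"
    using frac_h_members(1)[OF assms(1), of d] frac_h_members(1)[OF assms(2), of e]
    by (intro UN_pairs_constant *) (blast, blast)
  finally show ?thesis .
qed

lemma frac_h_add:
  assumes "f \<in> RX" "g \<in> RX"
  shows "frac_h h f d \<oplus>\<^bsub>RXh h\<^esub> frac_h h g e = frac_h h (h ^ e * f + h ^ d * g) (d + e)"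
proof -
  let ?F = "\<lambda>r s r' s'. loc_frac polyRX (range (\<lambda>d. h ^ d)) (s' * r + s * r') (s * s')"
  have *: "?F r s r' s' = frac_h h (h ^ e * f + h ^ d * g) (d + e)"
    if x: "(r, s) \<in> frac_h h f d" and y: "(r', s') \<in> frac_h h g e" for r s r' s'
  proof -
    obtain d' u where r: "s = h ^ d'" "r \<in> RX" "h ^ (u + d') * f = h ^ (u + d) * r"
      using frac_h_members(2)[OF assms(1) x] by blast
    obtain e' v where r': "s' = h ^ e'" "r' \<in> RX" "h ^ (v + e') * g = h ^ (v + e) * r'"
      using frac_h_members(2)[OF assms(2) y] by blast
    have "h ^ (u + v + (d + e)) * (h ^ e' * r + h ^ d' * r')
      = h ^ (v + e + e') * (h ^ (u + d) * r) + h ^ (u + d + d') * (h ^ (v + e) * r')"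
      by (simp add: power_add algebra_simps)
    also have "\<dots> = h ^ (u + v + (d' + e')) * (h ^ e * f + h ^ d * g)"
      unfolding r(3)[symmetric] r'(3)[symmetric] by (simp add: power_add algebra_simps)
    finally have "frac_h h (h ^ e' * r + h ^ d' * r') (d' + e') =
      frac_h h (h ^ e * f + h ^ d * g) (d + e)"
      by (intro frac_h_eq_iff[THEN iffD2] exI[of _ "u + v"] RX_closed assms r(2) r'(2) h)
    then show ?thesis using r r' by (simp add: frac_h_def power_add)
  qed
  have "frac_h h f d \<oplus>\<^bsub>RXh h\<^esub> frac_h h g e =
    (\<Union>(r, s)\<in>frac_h h f d. \<Union>(r', s')\<in>frac_h h g e. ?F r s r' s')"
    by (simp add: RXh_def loc_ring_def polyRX_simps)
  also have "\<dots> = frac_h h (h ^ e * f + h ^ d * g) (d + e)"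
    using frac_h_members(1)[OF assms(1), of d] frac_h_members(1)[OF assms(2), of e]
    by (intro UN_pairs_constant *) (blast, blast)
  finally show ?thesis .
qed

lemma RXh_carrier: "carrier (RXh h) = {frac_h h f d |f d. f \<in> RX}"
  by (auto simp: RXh_def loc_ring_def polyRX_simps quotient_def frac_h_def loc_frac_def)

lemma RXh_one_zero: "\<one>\<^bsub>RXh h\<^esub> = frac_h h 1 0" "\<zero>\<^bsub>RXh h\<^esub> = frac_h h 0 0"
  by (simp_all add: RXh_def loc_ring_def polyRX_simps frac_h_def)

lemma frac_h_carrier: "f \<in> RX \<Longrightarrow> frac_h h f d \<in> carrier (RXh h)"
  by (auto simp: RXh_carrier)

lemma frac_h_numerator_zero: "frac_h h 0 d = \<zero>\<^bsub>RXh h\<^esub>"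
  using frac_h_eq_iff[of 0 0 d 0] RX_closed(1) by (simp add: RXh_one_zero)

lemma RXh_ring: "ring (RXh h)"
proof (rule ringI)
  note ops = frac_h_mult frac_h_add RX_closed h
  show "abelian_group (RXh h)"
  proof (rule abelian_groupI)
    fix x assume "x \<in> carrier (RXh h)"
    then obtain f d where x: "f \<in> RX" "x = frac_h h f d" by (auto simp: RXh_carrier)
    have "frac_h h (- f) d \<oplus>\<^bsub>RXh h\<^esub> x = frac_h h (h ^ d * (- f) + h ^ d * f) (d + d)"
      unfolding x(2) by (intro frac_h_add RX_closed x(1))
    then show "\<exists>y\<in>carrier (RXh h). y \<oplus>\<^bsub>RXh h\<^esub> x = \<zero>\<^bsub>RXh h\<^esub>"
      using x RX_closed(4) by (intro bexI[of _ "frac_h h (- f) d"])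
        (auto simp: frac_h_numerator_zero intro: frac_h_carrier)
    show "\<zero>\<^bsub>RXh h\<^esub> \<oplus>\<^bsub>RXh h\<^esub> x = x"
      using x by (simp add: RXh_one_zero frac_h_add RX_closed(1))
    fix y assume "y \<in> carrier (RXh h)"
    then obtain g e where y: "g \<in> RX" "y = frac_h h g e" by (auto simp: RXh_carrier)
    show "x \<oplus>\<^bsub>RXh h\<^esub> y \<in> carrier (RXh h)" "x \<oplus>\<^bsub>RXh h\<^esub> y = y \<oplus>\<^bsub>RXh h\<^esub> x"
      using x y by (simp_all add: ops frac_h_carrier ac_simps)
    fix z assume "z \<in> carrier (RXh h)"
    then obtain k l where z: "k \<in> RX" "z = frac_h h k l" by (auto simp: RXh_carrier)
    show "x \<oplus>\<^bsub>RXh h\<^esub> y \<oplus>\<^bsub>RXh h\<^esub> z = x \<oplus>\<^bsub>RXh h\<^esub> (y \<oplus>\<^bsub>RXh h\<^esub> z)"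
      using x y z by (simp add: ops algebra_simps power_add)
  qed (simp add: RXh_one_zero frac_h_carrier RX_closed(1))
  show "monoid (RXh h)"
  proof (rule monoidI)
    fix x y z assume "x \<in> carrier (RXh h)" "y \<in> carrier (RXh h)" "z \<in> carrier (RXh h)"
    then show "x \<otimes>\<^bsub>RXh h\<^esub> y \<otimes>\<^bsub>RXh h\<^esub> z = x \<otimes>\<^bsub>RXh h\<^esub> (y \<otimes>\<^bsub>RXh h\<^esub> z)"
      by (auto simp: RXh_carrier ops ac_simps)
  next
    fix x y assume "x \<in> carrier (RXh h)" "y \<in> carrier (RXh h)"
    then show "x \<otimes>\<^bsub>RXh h\<^esub> y \<in> carrier (RXh h)"
      by (auto simp: RXh_carrier frac_h_mult) (metis RX_closed(5))
  qed (auto simp: RXh_one_zero RXh_carrier ops)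
  fix x y z assume "x \<in> carrier (RXh h)" "y \<in> carrier (RXh h)" "z \<in> carrier (RXh h)"
  then obtain f d g e k l where xyz: "x = frac_h h f d" "y = frac_h h g e" "z = frac_h h k l"
    "f \<in> RX" "g \<in> RX" "k \<in> RX" by (auto simp: RXh_carrier)
  show "(x \<oplus>\<^bsub>RXh h\<^esub> y) \<otimes>\<^bsub>RXh h\<^esub> z = x \<otimes>\<^bsub>RXh h\<^esub> z \<oplus>\<^bsub>RXh h\<^esub> y \<otimes>\<^bsub>RXh h\<^esub> z"
    "z \<otimes>\<^bsub>RXh h\<^esub> (x \<oplus>\<^bsub>RXh h\<^esub> y) = z \<otimes>\<^bsub>RXh h\<^esub> x \<oplus>\<^bsub>RXh h\<^esub> z \<otimes>\<^bsub>RXh h\<^esub> y"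
    unfolding xyz using xyz(4-)
    by (simp_all add: ops frac_h_eq_iff, simp_all add: algebra_simps power_add)
qed

text \<open>
  The fractions with numerator in \<open>J\<close> already form an ideal, as a common denominator of two of them is again a power of \<open>h\<close>.
  Membership in the extended ideal thus means having one representative with numerator in \<open>J\<close>.
\<close>

lemma RXh_genideal:
  assumes J: "J \<subseteq> RX" "0 \<in> J" "\<And>f g. f \<in> J \<Longrightarrow> g \<in> J \<Longrightarrow> f + g \<in> J"
    "\<And>r f. r \<in> RX \<Longrightarrow> f \<in> J \<Longrightarrow> r * f \<in> J"
  shows "Idl\<^bsub>RXh h\<^esub> ((\<lambda>f. frac_h h f 0) ` J) = {frac_h h f d |f d. f \<in> J}" (is "_ = ?K")
proof
  interpret ring "RXh h" by (rule RXh_ring)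
  have "ideal ?K (RXh h)"
  proof (rule idealI)
    show "subgroup ?K (add_monoid (RXh h))"
    proof (rule add.subgroupI)
      show "?K \<subseteq> carrier (RXh h)" using J(1) frac_h_carrier by blast
      show "?K \<noteq> {}" using J(2) by blast
      fix x assume "x \<in> ?K"
      then obtain f d where x: "f \<in> J" "x = frac_h h f d" by blast
      then have f: "f \<in> RX" using J(1) by blast
      have mf: "- f \<in> J" using J(4)[OF RX_closed(4)[OF RX_closed(2)] x(1)] by simp
      have "frac_h h (- f) d \<oplus>\<^bsub>RXh h\<^esub> x = frac_h h (h ^ d * (- f) + h ^ d * f) (d + d)"
        unfolding x(2) by (intro frac_h_add RX_closed f)
      then have "\<ominus>\<^bsub>RXh h\<^esub> x = frac_h h (- f) d"
        using x f RX_closed(4) frac_h_carrier by (intro minus_equality) (auto simp: frac_h_numerator_zero)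
      then show "\<ominus>\<^bsub>RXh h\<^esub> x \<in> ?K" using mf by blast
      fix y assume "y \<in> ?K"
      then obtain g e where y: "g \<in> J" "y = frac_h h g e" by blast
      then have "x \<oplus>\<^bsub>RXh h\<^esub> y = frac_h h (h ^ e * f + h ^ d * g) (d + e)"
        using x f J(1) by (simp add: frac_h_add subset_iff)
      moreover have "h ^ e * f + h ^ d * g \<in> J" using J(3,4) x y RX_closed(6)[OF h] by blast
      ultimately show "x \<oplus>\<^bsub>RXh h\<^esub> y \<in> ?K" by blast
    qed
    fix x y assume "x \<in> ?K" "y \<in> carrier (RXh h)"
    then obtain f d g e where xy: "f \<in> J" "x = frac_h h f d" "g \<in> RX" "y = frac_h h g e"
      by (auto simp: RXh_carrier)
    then have f: "f \<in> RX" using J(1) by blast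
    have "g * f \<in> J" "f * g \<in> J" using J(4)[OF xy(3,1)] by (simp_all add: mult.commute)
    then show "y \<otimes>\<^bsub>RXh h\<^esub> x \<in> ?K" "x \<otimes>\<^bsub>RXh h\<^esub> y \<in> ?K"
      using xy f by (auto simp: frac_h_mult)
  qed (rule RXh_ring)
  then show "Idl\<^bsub>RXh h\<^esub> ((\<lambda>f. frac_h h f 0) ` J) \<subseteq> ?K"
    by (rule genideal_minimal) blast
  have gens: "(\<lambda>f. frac_h h f 0) ` J \<subseteq> carrier (RXh h)" using J(1) frac_h_carrier by blast
  interpret E: ideal "Idl\<^bsub>RXh h\<^esub> ((\<lambda>f. frac_h h f 0) ` J)" "RXh h"
    using gens by (rule genideal_ideal)
  show "?K \<subseteq> Idl\<^bsub>RXh h\<^esub> ((\<lambda>f. frac_h h f 0) ` J)"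
  proof clarify
    fix f d assume f: "f \<in> J"
    have "frac_h h f 0 \<otimes>\<^bsub>RXh h\<^esub> frac_h h 1 d \<in> Idl\<^bsub>RXh h\<^esub> ((\<lambda>f. frac_h h f 0) ` J)"
      using genideal_self[OF gens] f frac_h_carrier RX_closed(2) by (intro E.I_r_closed) auto
    then show "frac_h h f d \<in> Idl\<^bsub>RXh h\<^esub> ((\<lambda>f. frac_h h f 0) ` J)"
      using f J(1) by (simp add: frac_h_mult subset_iff RX_closed(2))
  qed
qed

end

section \<open>The colon ideal \<open>J\<^sub>b\<close>\<close>

lemma my_power_simps:
  fixes b :: nat
  shows "(my :: ('n::finite, 'm::finite, 'k::field) bpoly set) [^]\<^bsub>ideals_set polyR\<^esub> (0::nat) = UNIV"
    and "(my :: ('n, 'm, 'k) bpoly set) [^]\<^bsub>ideals_set polyR\<^esub> Suc b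
      = ideal_prod polyR (my [^]\<^bsub>ideals_set polyR\<^esub> b) my"
  by (simp_all add: nat_pow_def ideals_set_def)

lemma my_ydeg:
  assumes "f \<in> my" "t \<in> Poly_Mapping.keys f"
  shows "1 \<le> ydeg t"
proof -
  let ?K = "{f :: ('a, 'b, 'c) bpoly. \<forall>t\<in>Poly_Mapping.keys f. 1 \<le> ydeg t}"
  have "ideal ?K polyR"
  proof (rule polyR_idealI)
    show "f + g \<in> ?K" if "f \<in> ?K" "g \<in> ?K" for f g
      using that Poly_Mapping.keys_add[of f g] by blast
    show "r * f \<in> ?K" if "f \<in> ?K" for r f
      using that Poly_Mapping.keys_mult[of r f] by fastforce
  qed simp
  moreover have "range (\<lambda>j. Poly_Mapping.single (yvar j) 1) \<subseteq> ?K" by auto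
  ultimately have "my \<subseteq> ?K" unfolding my_def by (rule polyR_genideal_minimal)
  then show ?thesis using assms by blast
qed

lemma my_power_ydeg:
  assumes "f \<in> my [^]\<^bsub>ideals_set polyR\<^esub> b" "t \<in> Poly_Mapping.keys f"
  shows "b \<le> ydeg t"
proof -
  have "\<forall>t\<in>Poly_Mapping.keys f. b \<le> ydeg t" using assms(1)
  proof (induction b arbitrary: f)
    case (Suc b)
    from Suc.prems have "f \<in> ideal_prod polyR (my [^]\<^bsub>ideals_set polyR\<^esub> b) my"
      by (simp only: my_power_simps)
    then show ?case
    proof (induction rule: ideal_prod.induct)
      case (prod i j)
      show ?case
      proof
        fix t assume "t \<in> Poly_Mapping.keys (i \<otimes>\<^bsub>polyR\<^esub> j)"
        then obtain s s' where "s \<in> Poly_Mapping.keys i" "s' \<in> Poly_Mapping.keys j" "t = s + s'"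
          using Poly_Mapping.keys_mult[of i j] by auto
        moreover from this have "b \<le> ydeg s" "1 \<le> ydeg s'"
          using Suc.IH prod my_ydeg by blast+
        ultimately show "Suc b \<le> ydeg t" by simp
      qed
    next
      case (sum f g)
      then show ?case using Poly_Mapping.keys_add[of f g] by (auto simp del: One_nat_def)
    qed
  qed simp
  then show ?thesis using assms(2) by blast
qed

lemma bicomp_subset_my_power:
  "bicomp a b \<subseteq> (my [^]\<^bsub>ideals_set polyR\<^esub> b :: ('n::finite, 'm::finite, 'k::field) bpoly set)"
proof (induction b)
  case (Suc b)
  show ?case
  proof
    let ?P = "ideal_prod polyR (my [^]\<^bsub>ideals_set polyR\<^esub> b) my :: ('n, 'm, 'k) bpoly set"
    fix f :: "('n, 'm, 'k) bpoly" assume "f \<in> bicomp a (Suc b)"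
    then have "f \<in> ?P"
    proof (induction rule: bicomp_induct)
      case zero
      have "(0 :: ('n, 'm, 'k) bpoly) \<in> my"
        unfolding my_def by (rule polyR_idealD(1)[OF polyR_genideal])
      moreover have "0 \<in> (my [^]\<^bsub>ideals_set polyR\<^esub> b :: ('n, 'm, 'k) bpoly set)"
        using Suc.IH bicomp_zero by blast
      ultimately show ?case using ideal_prod.prod[of 0 _ 0 my polyR] by simp
    next
      case (add f g)
      then show ?case using ideal_prod.sum[of f polyR _ _ g] by simp
    next
      case (single t c)
      then have "ydeg t > 0" by simp
      then obtain j s where t: "t = yvar j + s" by (rule ydeg_pos_split)
      have "Poly_Mapping.single (yvar j) 1 \<in> (my :: ('n, 'm, 'k) bpoly set)"
        unfolding my_def by (rule subsetD[OF polyR_genideal_self]) blast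
      moreover have "Poly_Mapping.single s c \<in> (my [^]\<^bsub>ideals_set polyR\<^esub> b :: ('n, 'm, 'k) bpoly set)"
        by (rule subsetD[OF Suc.IH]) (use single t in \<open>auto intro: bicomp_single\<close>)
      ultimately have "Poly_Mapping.single s c \<otimes>\<^bsub>polyR\<^esub> Poly_Mapping.single (yvar j) 1 \<in> ?P"
        by (intro ideal_prod.prod)
      then show ?case unfolding t by (simp add: mult_single add.commute)
    qed
    then show "f \<in> my [^]\<^bsub>ideals_set polyR\<^esub> Suc b" by (simp only: my_power_simps)
  qed
qed (simp only: my_power_simps subset_UNIV)

lemma split_off_y_monomial:
  assumes "b \<le> ydeg t"
  obtains r s where "t = r + s" "xdeg s = 0" "ydeg s = b"
proof -
  have "\<exists>r s. t = r + s \<and> xdeg s = 0 \<and> ydeg s = b"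
    using assms
  proof (induction b)
    case 0
    then show ?case by (intro exI[of _ t] exI[of _ 0]) simp
  next
    case (Suc b)
    then obtain r s where rs: "t = r + s" "xdeg s = 0" "ydeg s = b" by auto
    then have "ydeg r > 0" using Suc.prems by simp
    then obtain j r' where "r = yvar j + r'" by (rule ydeg_pos_split)
    then show ?case using rs by (intro exI[of _ r'] exI[of _ "yvar j + s"]) (simp add: ac_simps)
  qed
  then show thesis using that by blast
qed

text \<open>
  It suffices to test \<open>f\<close> on \<open>R\<^bsub>0,b\<^esub>\<close>, since every monomial of \<open>y\<close>-degree at least \<open>b\<close> is a multiple of one in
  \<open>R\<^bsub>0,b\<^esub>\<close>, and \<open>\<mm>\<^sub>y\<^sup>b\<close> contains no other monomials.
\<close>

lemma Jb_iff:
  assumes I: "ideal I polyR"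
  shows "f \<in> Jb I b \<longleftrightarrow> f \<in> RX \<and> (\<forall>p\<in>bicomp 0 b. f * p \<in> I)"
proof -
  have "f * q \<in> I" if f: "\<forall>p\<in>bicomp 0 b. f * p \<in> I" and q: "\<forall>t\<in>Poly_Mapping.keys q. b \<le> ydeg t" for q
  proof (induction q rule: poly_term_induct)
    case (single t c)
    with q obtain r s where t: "t = r + s" "xdeg s = 0" "ydeg s = b"
      using split_off_y_monomial by blast
    then have "f * Poly_Mapping.single s c \<in> I" using f by (simp add: bicomp_single)
    then have "Poly_Mapping.single r 1 * (f * Poly_Mapping.single s c) \<in> I"
      by (rule polyR_idealD(3)[OF I])
    then show ?case unfolding t by (simp add: mult_single mult.left_commute)
  qed (use polyR_idealD[OF I] in \<open>auto simp: distrib_left\<close>)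
  then show ?thesis
    using bicomp_subset_my_power[of 0 b] my_power_ydeg[of _ b]
    by (auto simp: Jb_def colon_ideal_def polyRX_simps)
qed

lemma Jb_annihilates:
  assumes I: "ideal I polyR" and f: "f \<in> Jb I b" and p: "p \<in> bicomp a b"
  shows "f * p \<in> I"
  using f p bicomp_subset_my_power[of a b] by (auto simp: Jb_def colon_ideal_def)

lemma Jb_RX_ideal:
  assumes I: "ideal I polyR"
  shows "Jb I b \<subseteq> RX" "0 \<in> Jb I b" "f \<in> Jb I b \<Longrightarrow> g \<in> Jb I b \<Longrightarrow> f + g \<in> Jb I b"
    "r \<in> RX \<Longrightarrow> f \<in> Jb I b \<Longrightarrow> r * f \<in> Jb I b"
  using polyR_idealD[OF I]
  by (auto simp: Jb_iff[OF I] RX_closed distrib_right mult.assoc)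

section \<open>The kernel\<close>

context
  fixes I :: "('n::finite, 'm::finite, 'k::field) bpoly set" and a b :: nat and h :: "('n, 'm, 'k) bpoly"
  assumes bihom: "bihomogeneous_ideal I" and gen: "generated_upto I a b"
    and form: "admissible_form I a b h"
begin

lemma I_ideal: "ideal I polyR"
  using bihom by (simp add: bihomogeneous_ideal_def)

lemma form_deg: "h \<in> bicomp 1 0"
  using form by (simp add: admissible_form_def)

lemma form_RX: "h \<in> RX"
  using form_deg by (rule bicomp_RX)

lemma mbar_rcos:
  "f \<in> bicomp a b \<Longrightarrow> mbar I a b g (I +>\<^bsub>polyR\<^esub> f) = I +>\<^bsub>polyR\<^esub> (g * f)"
  by (simp add: mbar_def quot_comp_simps[OF I_ideal] polyR_rcos_hom[OF I_ideal])

abbreviation (input) mquot where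
  "mquot d g \<equiv> compose (carrier (quot_comp I a b))
    (inv_into (carrier (quot_comp I a b)) (mbar I a b (h ^ d))) (mbar I a b g)"

lemma mbar_power_inj: "inj_on (mbar I a b (h ^ d)) (carrier (quot_comp I a b))"
proof (rule inj_onI)
  fix A B assume "A \<in> carrier (quot_comp I a b)" "B \<in> carrier (quot_comp I a b)"
    and eq: "mbar I a b (h ^ d) A = mbar I a b (h ^ d) B"
  then obtain f g where fg: "f \<in> bicomp a b" "g \<in> bicomp a b" "A = I +>\<^bsub>polyR\<^esub> f" "B = I +>\<^bsub>polyR\<^esub> g"
    by (auto simp: quot_comp_simps[OF I_ideal])
  with eq have "h ^ d * (f - g) \<in> I"
    by (simp add: mbar_rcos polyR_rcos_eq_iff[OF I_ideal] right_diff_distrib)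
  then have "f - g \<in> I"
    using admissible_form_power_bijective(2)[OF bihom gen form order_refl] bicomp_diff fg by blast
  then show "A = B" using fg by (simp add: polyR_rcos_eq_iff[OF I_ideal])
qed

lemma mquot_rcos:
  assumes f: "f \<in> bicomp a b" and w: "w \<in> bicomp a b" and eq: "g * f - h ^ d * w \<in> I"
  shows "mquot d g (I +>\<^bsub>polyR\<^esub> f) = I +>\<^bsub>polyR\<^esub> w"
proof -
  have wC: "I +>\<^bsub>polyR\<^esub> w \<in> carrier (quot_comp I a b)" and fC: "I +>\<^bsub>polyR\<^esub> f \<in> carrier (quot_comp I a b)"
    using w f by (simp_all add: quot_comp_simps[OF I_ideal])
  have "mbar I a b g (I +>\<^bsub>polyR\<^esub> f) = mbar I a b (h ^ d) (I +>\<^bsub>polyR\<^esub> w)"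
    using f w eq by (simp add: mbar_rcos polyR_rcos_eq_iff[OF I_ideal])
  then show ?thesis
    using fC wC inv_into_f_f[OF mbar_power_inj] by (simp add: compose_eq)
qed

lemma mquot_rcos_ex:
  assumes g: "g \<in> bicomp d 0" and f: "f \<in> bicomp a b"
  shows "\<exists>w\<in>bicomp a b. g * f - h ^ d * w \<in> I"
  using admissible_form_power_bijective(1)[OF bihom gen form order_refl, of "g * f" d]
    bicomp_mult[OF g f] by (simp add: add.commute)

text \<open>
  Two representatives \<open>g/h\<^sup>d\<close> and \<open>g'/h\<^sup>d'\<close> satisfy \<open>h\<^sup>u\<^sup>+\<^sup>d\<^sup>' g = h\<^sup>u\<^sup>+\<^sup>d g'\<close> for some \<open>u\<close>. So the two images \<open>[w]\<close>, \<open>[w']\<close> of a class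
  \<open>[f]\<close> agree after multiplication by \<open>h\<^sup>u\<^sup>+\<^sup>d\<^sup>+\<^sup>d\<^sup>'\<close>, which is injective on \<open>(R/I)\<^bsub>a,b\<^esub>\<close>. Hence the set in the definition of
  \<open>mfrac\<close> is a singleton.
\<close>

lemma mfrac_frac_h:
  assumes g: "g \<in> bicomp d 0"
  shows "mfrac I a b h (frac_h h g d) = mquot d g"
proof -
  have "mquot d' g' = mquot d g"
    if g': "g' \<in> bicomp d' 0" and eq: "frac_h h g d = frac_h h g' d'" for g' d'
  proof (rule extensionalityI[of _ "carrier (quot_comp I a b)"])
    fix A assume "A \<in> carrier (quot_comp I a b)"
    then obtain f where f: "f \<in> bicomp a b" "A = I +>\<^bsub>polyR\<^esub> f"
      by (auto simp: quot_comp_simps[OF I_ideal])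
    obtain u where u: "h ^ (u + d') * g = h ^ (u + d) * g'"
      using eq frac_h_eq_iff[OF form_RX bicomp_RX[OF g] bicomp_RX[OF g']] by blast
    obtain w where w: "w \<in> bicomp a b" "g * f - h ^ d * w \<in> I"
      using mquot_rcos_ex[OF g f(1)] by blast
    obtain w' where w': "w' \<in> bicomp a b" "g' * f - h ^ d' * w' \<in> I"
      using mquot_rcos_ex[OF g' f(1)] by blast
    have "h ^ (u + d + d') * (w - w') = h ^ (u + d) * (g' * f - h ^ d' * w')
      - h ^ (u + d') * (g * f - h ^ d * w) + (h ^ (u + d') * g - h ^ (u + d) * g') * f"
      by (simp add: algebra_simps power_add)
    also have "\<dots> \<in> I"
      using polyR_idealD[OF I_ideal] w(2) w'(2) unfolding u by simp
    finally have "w - w' \<in> I"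
      using admissible_form_power_bijective(2)[OF bihom gen form order_refl] bicomp_diff w(1) w'(1)
      by blast
    then show "mquot d' g' A = mquot d g A"
      unfolding f(2) mquot_rcos[OF f(1) w] mquot_rcos[OF f(1) w']
      using polyR_rcos_eq_iff[OF I_ideal] by metis
  qed (simp_all add: compose_extensional)
  then have "{mquot d' g' |g' d'. g' \<in> bicomp d' 0 \<and> frac_h h g d = frac_h h g' d'} = {mquot d g}"
    using g by blast
  then show ?thesis unfolding mfrac_def by simp
qed

lemma mquot_zero_iff:
  assumes g: "g \<in> bicomp d 0"
  shows "mquot d g = \<zero>\<^bsub>mult_algebra I a b h\<^esub> \<longleftrightarrow> (\<forall>f\<in>bicomp a b. g * f \<in> I)"
proof -
  have zero: "\<zero>\<^bsub>mult_algebra I a b h\<^esub> = (\<lambda>v\<in>carrier (quot_comp I a b). I +>\<^bsub>polyR\<^esub> 0)"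
    by (simp add: mult_algebra_def End_ring_def Let_def quot_comp_simps[OF I_ideal])
  have val: "mquot d g (I +>\<^bsub>polyR\<^esub> f) = I +>\<^bsub>polyR\<^esub> 0 \<longleftrightarrow> g * f \<in> I" if f: "f \<in> bicomp a b" for f
  proof -
    obtain w where w: "w \<in> bicomp a b" "g * f - h ^ d * w \<in> I"
      using mquot_rcos_ex[OF g f] by blast
    have "w \<in> I \<longleftrightarrow> h ^ d * w \<in> I"
      using admissible_form_power_bijective(2)[OF bihom gen form order_refl w(1)]
        polyR_idealD(3)[OF I_ideal] by blast
    also have "\<dots> \<longleftrightarrow> g * f \<in> I"
      using polyR_idealD(2)[OF I_ideal w(2), of "h ^ d * w"]
        polyR_idealD(5)[OF I_ideal _ w(2), of "g * f"] by auto
    finally show ?thesis using mquot_rcos[OF f w] by (simp add: polyR_rcos_eq_iff[OF I_ideal])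
  qed
  show ?thesis
  proof
    assume "mquot d g = \<zero>\<^bsub>mult_algebra I a b h\<^esub>"
    then have "mquot d g (I +>\<^bsub>polyR\<^esub> f) = I +>\<^bsub>polyR\<^esub> 0" if "f \<in> bicomp a b" for f
      using that by (simp add: zero quot_comp_simps(1)[OF I_ideal])
    then show "\<forall>f\<in>bicomp a b. g * f \<in> I" using val by blast
  next
    assume *: "\<forall>f\<in>bicomp a b. g * f \<in> I"
    show "mquot d g = \<zero>\<^bsub>mult_algebra I a b h\<^esub>"
    proof (rule extensionalityI[of _ "carrier (quot_comp I a b)"])
      fix A assume A: "A \<in> carrier (quot_comp I a b)"
      then obtain f where "f \<in> bicomp a b" "A = I +>\<^bsub>polyR\<^esub> f"
        by (auto simp: quot_comp_simps[OF I_ideal])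
      then show "mquot d g A = \<zero>\<^bsub>mult_algebra I a b h\<^esub> A"
        using val * A by (simp add: zero)
    qed (simp_all add: compose_extensional zero)
  qed
qed

text \<open>
  If \<open>g/h\<^sup>d = f/h\<^sup>e\<close> with \<open>f \<in> J\<^sub>b\<close>, then some \<open>h\<^sup>k g\<close> kills \<open>(R/I)\<^bsub>a,b\<^esub>\<close>, and \<open>h\<^sup>k\<close> cancels because it is injective on
  \<open>(R/I)\<^bsub>d+a,b\<^esub>\<close>. Conversely, an element \<open>g\<close> that kills \<open>(R/I)\<^bsub>a,b\<^esub>\<close> need not lie in \<open>J\<^sub>b\<close>, but \<open>h\<^sup>a g\<close> does:
  \<open>h\<^sup>a\<close> carries \<open>R\<^bsub>0,b\<^esub>\<close> into \<open>R\<^bsub>a,b\<^esub>\<close>.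
\<close>

lemma loc_ideal0_Jb_iff:
  assumes g: "g \<in> bicomp d 0"
  shows "frac_h h g d \<in> loc_ideal0 h (Jb I b) \<longleftrightarrow> (\<forall>f\<in>bicomp a b. g * f \<in> I)"
proof -
  have "frac_h h g d \<in> carrier (RXh0 h)" using g by (auto simp: RXh0_def)
  then have "frac_h h g d \<in> loc_ideal0 h (Jb I b) \<longleftrightarrow>
    (\<exists>f e. f \<in> Jb I b \<and> frac_h h g d = frac_h h f e)"
    unfolding loc_ideal0_def
    using RXh_genideal[OF form_RX Jb_RX_ideal[OF I_ideal]] by auto
  also have "\<dots> \<longleftrightarrow> (\<forall>p\<in>bicomp a b. g * p \<in> I)"
  proof
    assume "\<exists>f e. f \<in> Jb I b \<and> frac_h h g d = frac_h h f e"
    then obtain f e u where f: "f \<in> Jb I b" and u: "h ^ (u + e) * g = h ^ (u + d) * f"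
      using frac_h_eq_iff[OF form_RX bicomp_RX[OF g]] Jb_RX_ideal(1)[OF I_ideal] by blast
    show "\<forall>p\<in>bicomp a b. g * p \<in> I"
    proof
      fix p :: "('n, 'm, 'k) bpoly" assume p: "p \<in> bicomp a b"
      have "h ^ (u + e) * (g * p) = h ^ (u + d) * (f * p)"
        using u by (simp add: mult.assoc[symmetric])
      also have "\<dots> \<in> I"
        using Jb_annihilates[OF I_ideal f p] by (rule polyR_idealD(3)[OF I_ideal])
      finally show "g * p \<in> I"
        using admissible_form_power_bijective(2)[OF bihom gen form, of "d + a" "g * p"]
          bicomp_mult[OF g p] by simp
    qed
  next
    assume *: "\<forall>p\<in>bicomp a b. g * p \<in> I"
    have gRX: "g \<in> RX" using g by (rule bicomp_RX)
    then have RX: "h ^ a * g \<in> RX" by (intro RX_closed form_RX)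
    have "h ^ a * g * p \<in> I" if p: "p \<in> bicomp 0 b" for p
    proof -
      have "h ^ a * p \<in> bicomp a b" using bicomp_mult[OF bicomp_power[OF form_deg] p] by simp
      with * have "g * (h ^ a * p) \<in> I" by blast
      then show ?thesis by (simp add: ac_simps)
    qed
    with RX have "h ^ a * g \<in> Jb I b" by (simp add: Jb_iff[OF I_ideal])
    moreover have "frac_h h g d = frac_h h (h ^ a * g) (d + a)"
      by (subst frac_h_eq_iff[OF form_RX gRX RX]) (simp add: power_add ac_simps)
    ultimately show "\<exists>f e. f \<in> Jb I b \<and> frac_h h g d = frac_h h f e" by blast
  qed
  finally show ?thesis .
qed

lemma kernel_mfrac:
  "a_kernel (RXh0 h) (mult_algebra I a b h) (mfrac I a b h) = loc_ideal0 h (Jb I b)"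
proof -
  have carrier: "carrier (RXh0 h) = {frac_h h g d |g d. g \<in> bicomp d 0}"
    by (simp add: RXh0_def)
  have "loc_ideal0 h (Jb I b) \<subseteq> carrier (RXh0 h)" by (simp add: loc_ideal0_def)
  moreover have "mfrac I a b h (frac_h h g d) = \<zero>\<^bsub>mult_algebra I a b h\<^esub> \<longleftrightarrow>
      frac_h h g d \<in> loc_ideal0 h (Jb I b)" if "g \<in> bicomp d 0" for g d
    using that mfrac_frac_h mquot_zero_iff loc_ideal0_Jb_iff by simp
  ultimately show ?thesis
    unfolding a_kernel_def' carrier by blast
qed

end

theorem theorem3p6:
  fixes I :: "('n::finite, 'm::finite, 'k::field) bpoly set"
    and a b :: nat
    and h :: "('n, 'm, 'k) bpoly"
  assumes "bihomogeneous_ideal I"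
    and "admissible I a b"
    and "admissible_form I a b h"
  shows "a_kernel (RXh0 h) (mult_algebra I a b h) (mfrac I a b h) = loc_ideal0 h (Jb I b)"
proof (rule kernel_mfrac)
  show "generated_upto I a b" using assms(2) unfolding admissible_def by (rule conjunct1)
qed (fact assms)+

end
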